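(* Let $X$ and $Y$ be MAP topological groups. (1) $X\in\mathfrak{RS}$ if and only if $(\mathbf{s}\circ\mathfrak{B})(X)=\mathbf{s}(X)$. (2) $X\in\mathbf{S}\cap\mathfrak{RS}$ if and only if $(\mathbf{s}\circ\mathfrak{B})(X)=X$. (3) $\mathbf{S}\cap\mathfrak{RS}\subsetneqq\mathbf{S}$ and $\mathbf{S}\cap\mathfrak{RS}\subsetneqq\mathfrak{RS}$. (4) Let $X\in\mathbf{S}$ and $Y\in\mathfrak{RS}$ and let $\phi:X\to Y$ be a homomorphism. If $\phi^+:X^+\to Y^+$, $\phi^+(x):=\phi(x)$, is continuous, then $\phi$ is continuous.
   Context: Groups are Hausdorff and not necessarily Abelian. For a topological group $X$ let $bX$ be its Bohr compactification, with canonical continuous homomorphism $i:X\to bX$ onto a dense subgroup. $X^+$ is the group $X$ with the topology induced from $bX$ via $i$; $X$ is MAP if $X^+$ is Hausdorff. The Bohr functor is $\mathfrak{B}(X):=X^+$ on MAP groups. A MAP group $X$ has the Schur property if $X$ and $X^+$ have the same convergent sequences; $\mathfrak{RS}$ is the class of all MAP groups which have the Schur property. For a Hausdorff topological group $(X,\tau)$, let $S$ be the set of all sequences in $X$ converging to the unit in $\tau$, and let $\tau_S$ be the finest Hausdorff group topology on the underlying group $X$ in which all sequences of $S$ converge to the unit. Put $\mathbf{s}(X,\tau):=(X,\tau_S)$. $(X,\tau)$ is an $s$-group if $\tau=\tau_S$, and $\mathbf{S}$ is the class of all $s$-groups. Equalities between groups mean equality as topological groups (same underlying group and same topology). *)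

theory Defs
  imports "HOL-Analysis.Analysis" "HOL-Algebra.Product_Groups"
begin

section \<open>Topological groups\<close>

record 'a top_group = "'a monoid" +
  topol :: "'a topology"

definition topological_group :: "'a top_group \<Rightarrow> bool" where
  "topological_group X \<longleftrightarrow>
     group X \<and> topspace (topol X) = carrier X \<and>
     continuous_map (prod_topology (topol X) (topol X)) (topol X) (\<lambda>(x, y). x \<otimes>\<^bsub>X\<^esub> y) \<and>
     continuous_map (topol X) (topol X) (\<lambda>x. inv\<^bsub>X\<^esub> x)"

definition hausdorff_group :: "'a top_group \<Rightarrow> bool" where
  "hausdorff_group X \<longleftrightarrow> topological_group X \<and> Hausdorff_space (topol X)"

definition compact_group :: "'a top_group \<Rightarrow> bool" where
  "compact_group X \<longleftrightarrow> hausdorff_group X \<and> compact_space (topol X)"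

definition continuous_hom :: "'a top_group \<Rightarrow> 'b top_group \<Rightarrow> ('a \<Rightarrow> 'b) set" where
  "continuous_hom X Y = {f \<in> hom X Y. continuous_map (topol X) (topol Y) f}"

definition product_top_group :: "'i set \<Rightarrow> ('i \<Rightarrow> 'a top_group) \<Rightarrow> ('i \<Rightarrow> 'a) top_group" where
  "product_top_group I G =
     \<lparr>carrier = carrier (product_group I G), monoid.mult = monoid.mult (product_group I G),
      one = one (product_group I G), topol = product_topology (\<lambda>i. topol (G i)) I\<rparr>"

definition restrict_top_group :: "'a top_group \<Rightarrow> 'a set \<Rightarrow> 'a top_group" where
  "restrict_top_group X H = X\<lparr>carrier := H, topol := subtopology (topol X) H\<rparr>"

section \<open>Bohr compactification and Bohr functor\<close>

text \<open>The Bohr compactification of X is the closure of the canonical image of X in the product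
  of all compact Hausdorff groups K, taken over all continuous homomorphisms from X to K.
  A compact Hausdorff group with a dense image of X has at most as many points as there are
  sets of subsets of X, so it suffices to let K range over groups
  on the type \<^typ>\<open>'a set set\<close>; the lemma \<open>bohr_universal\<close> below is the universal property
  with respect to compact Hausdorff groups on an arbitrary type.\<close>

definition bohr_index :: "'a top_group \<Rightarrow> ('a set set top_group \<times> ('a \<Rightarrow> 'a set set)) set" where
  "bohr_index X = {(K, f). compact_group K \<and> f \<in> continuous_hom X K}"

definition bohr_product ::
  "'a top_group \<Rightarrow> ('a set set top_group \<times> ('a \<Rightarrow> 'a set set) \<Rightarrow> 'a set set) top_group" where
  "bohr_product X = product_top_group (bohr_index X) fst"

definition bohr_map ::
  "'a top_group \<Rightarrow> 'a \<Rightarrow> 'a set set top_group \<times> ('a \<Rightarrow> 'a set set) \<Rightarrow> 'a set set" where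
  "bohr_map X x = (\<lambda>k\<in>bohr_index X. snd k x)"

definition bohr_compactification ::
  "'a top_group \<Rightarrow> ('a set set top_group \<times> ('a \<Rightarrow> 'a set set) \<Rightarrow> 'a set set) top_group" where
  "bohr_compactification X =
     restrict_top_group (bohr_product X) (topol (bohr_product X) closure_of (bohr_map X ` carrier X))"

definition bohr :: "'a top_group \<Rightarrow> 'a top_group" where
  "bohr X =
     X\<lparr>topol := pullback_topology (carrier X) (bohr_map X) (topol (bohr_compactification X))\<rparr>"

definition MAP :: "'a top_group \<Rightarrow> bool" where
  "MAP X \<longleftrightarrow> hausdorff_group X \<and> Hausdorff_space (topol (bohr X))"

section \<open>The Schur property\<close>

definition convergent_seqs :: "'a top_group \<Rightarrow> (nat \<Rightarrow> 'a) set" where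
  "convergent_seqs X =
     {\<sigma>. range \<sigma> \<subseteq> carrier X \<and> (\<exists>l. limitin (topol X) \<sigma> l sequentially)}"

definition schur_groups :: "'a top_group set" where
  "schur_groups = {X. MAP X \<and> convergent_seqs X = convergent_seqs (bohr X)}"

section \<open>s-groups\<close>

definition null_seqs :: "'a top_group \<Rightarrow> (nat \<Rightarrow> 'a) set" where
  "null_seqs X =
     {\<sigma>. range \<sigma> \<subseteq> carrier X \<and> limitin (topol X) \<sigma> \<one>\<^bsub>X\<^esub> sequentially}"

definition null_admissible :: "'a top_group \<Rightarrow> 'a topology \<Rightarrow> bool" where
  "null_admissible X T \<longleftrightarrow>
     hausdorff_group (X\<lparr>topol := T\<rparr>) \<and>
     (\<forall>\<sigma>\<in>null_seqs X. limitin T \<sigma> \<one>\<^bsub>X\<^esub> sequentially)"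

definition is_finest_null_admissible :: "'a top_group \<Rightarrow> 'a topology \<Rightarrow> bool" where
  "is_finest_null_admissible X T \<longleftrightarrow>
     null_admissible X T \<and> (\<forall>T'. null_admissible X T' \<longrightarrow> (\<forall>U. openin T' U \<longrightarrow> openin T U))"

text \<open>By \<open>finest_null_admissible_exists\<close> and \<open>finest_null_admissible_unique\<close> below, the
  description in \<open>s_mod\<close> denotes for every Hausdorff topological group.\<close>

definition s_mod :: "'a top_group \<Rightarrow> 'a top_group" where
  "s_mod X = X\<lparr>topol := (THE T. is_finest_null_admissible X T)\<rparr>"

definition s_groups :: "'a top_group set" where
  "s_groups = {X. hausdorff_group X \<and> s_mod X = X}"

section \<open>Well-definedness\<close>

lemma group_cong:
  fixes G :: "('a, 'm) monoid_scheme" and H :: "('a, 'n) monoid_scheme"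
  assumes "carrier G = carrier H" "monoid.mult G = monoid.mult H" "one G = one H"
  shows "group G \<longleftrightarrow> group H"
  unfolding Group.group_def Group.monoid_def group_axioms_def Units_def by (simp only: assms)

lemma group_topol_update [simp]: "group (X\<lparr>topol := T\<rparr>) \<longleftrightarrow> group X"
  by (rule group_cong) simp_all

lemma inv_topol_update [simp]: "m_inv (X\<lparr>topol := T\<rparr>) = m_inv X"
  by (simp add: m_inv_def fun_eq_iff)

lemma finest_null_admissible_unique:
  "is_finest_null_admissible X T \<Longrightarrow> is_finest_null_admissible X T' \<Longrightarrow> T = T'"
  unfolding is_finest_null_admissible_def by (metis topology_eq)

lemma finest_null_admissible_exists:
  assumes X: "hausdorff_group X"
  shows "is_finest_null_admissible X (THE T. is_finest_null_admissible X T)"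
proof -
  define B where "B = {U. \<exists>T'. null_admissible X T' \<and> openin T' U}"
  define T where "T = topology_generated_by B"
  have adm0: "null_admissible X (topol X)"
    using X by (simp add: null_admissible_def null_seqs_def)
  have tsp: "topspace T' = carrier X" if "null_admissible X T'" for T'
    using that by (simp add: null_admissible_def hausdorff_group_def topological_group_def)
  have fine: "openin T U" if "null_admissible X T'" "openin T' U" for T' U
    unfolding T_def by (rule topology_generated_by_Basis) (use that in \<open>auto simp: B_def\<close>)
  have UB: "\<Union>B = carrier X"
  proof
    show "\<Union>B \<subseteq> carrier X"
      unfolding B_def using tsp openin_subset by blast
    show "carrier X \<subseteq> \<Union>B"
      using adm0 tsp[OF adm0] unfolding B_def by (metis (mono_tags, lifting) Union_upper mem_Collect_eq openin_topspace)
  qed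
  have tT: "topspace T = carrier X"
    unfolding T_def using UB by simp
  have idT: "continuous_map T T' id" if "null_admissible X T'" for T'
    using topology_finer_continuous_id[of T' T] tsp[OF that] tT fine[OF that] by simp
  have cts: "continuous_map S T f"
    if "\<And>T'. null_admissible X T' \<Longrightarrow> continuous_map S T' f" for S :: "'c topology" and f
    unfolding T_def
  proof (rule continuous_on_generated_topo)
    show "openin S (f -` U \<inter> topspace S)" if "U \<in> B" for U
      using that \<open>\<And>T'. null_admissible X T' \<Longrightarrow> continuous_map S T' f\<close>
      unfolding B_def continuous_map_alt by blast
    show "f ` topspace S \<subseteq> \<Union>B"
      using that[OF adm0] tsp[OF adm0] UB by (auto simp: continuous_map_def)
  qed
  have "null_admissible X T"
    unfolding null_admissible_def hausdorff_group_def topological_group_def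
  proof (intro conjI ballI)
    show "group (X\<lparr>topol := T\<rparr>)"
      using X by (simp add: hausdorff_group_def topological_group_def)
    show "topspace (topol (X\<lparr>topol := T\<rparr>)) = carrier (X\<lparr>topol := T\<rparr>)"
      by (simp add: tT)
    have "continuous_map (prod_topology T T) T (\<lambda>(x, y). x \<otimes>\<^bsub>X\<^esub> y)"
    proof (rule cts)
      fix T' assume T': "null_admissible X T'"
      have 1: "continuous_map (prod_topology T' T') T' (\<lambda>(x, y). x \<otimes>\<^bsub>X\<^esub> y)"
        using T' by (simp add: null_admissible_def hausdorff_group_def topological_group_def)
      have "continuous_map (prod_topology T T) (prod_topology T' T') (\<lambda>p. (id (fst p), id (snd p)))"
        by (intro continuous_map_pairedI continuous_map_compose[OF continuous_map_fst idT[OF T'], unfolded o_def]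
              continuous_map_compose[OF continuous_map_snd idT[OF T'], unfolded o_def])
      from continuous_map_compose[OF this 1]
      show "continuous_map (prod_topology T T) T' (\<lambda>(x, y). x \<otimes>\<^bsub>X\<^esub> y)"
        by (simp add: o_def case_prod_unfold)
    qed
    then show "continuous_map (prod_topology (topol (X\<lparr>topol := T\<rparr>)) (topol (X\<lparr>topol := T\<rparr>)))
        (topol (X\<lparr>topol := T\<rparr>)) (\<lambda>(x, y). x \<otimes>\<^bsub>X\<lparr>topol := T\<rparr>\<^esub> y)"
      by simp
    have "continuous_map T T (m_inv X)"
    proof (rule cts)
      fix T' assume T': "null_admissible X T'"
      have 1: "continuous_map T' T' (m_inv X)"
        using T' by (simp add: null_admissible_def hausdorff_group_def topological_group_def)
      from continuous_map_compose[OF idT[OF T'] this] show "continuous_map T T' (m_inv X)"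
        by simp
    qed
    then show "continuous_map (topol (X\<lparr>topol := T\<rparr>)) (topol (X\<lparr>topol := T\<rparr>))
        (m_inv (X\<lparr>topol := T\<rparr>))"
      by simp
    have "Hausdorff_space T"
      using Hausdorff_space_injective_preimage[OF _ idT[OF adm0]] X
      by (simp add: hausdorff_group_def)
    then show "Hausdorff_space (topol (X\<lparr>topol := T\<rparr>))" by simp
    fix \<sigma> assume \<sigma>: "\<sigma> \<in> null_seqs X"
    have one: "\<one>\<^bsub>X\<^esub> \<in> carrier X"
      using X by (simp add: hausdorff_group_def topological_group_def group.is_monoid monoid.one_closed)
    have "\<one>\<^bsub>X\<^esub> \<in> U \<longrightarrow> (\<forall>\<^sub>F n in sequentially. \<sigma> n \<in> U)" if "generate_topology_on B U" for U
      using that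
    proof induction
      case Empty then show ?case by simp
    next
      case (Int a b) then show ?case by (auto intro: eventually_conj)
    next
      case (UN K)
      show ?case
      proof
        assume "\<one>\<^bsub>X\<^esub> \<in> \<Union>K"
        then obtain k where "k \<in> K" "\<one>\<^bsub>X\<^esub> \<in> k" by blast
        with UN have "\<forall>\<^sub>F n in sequentially. \<sigma> n \<in> k" by blast
        then show "\<forall>\<^sub>F n in sequentially. \<sigma> n \<in> \<Union>K"
          by (rule eventually_mono) (use \<open>k \<in> K\<close> in blast)
      qed
    next
      case (Basis s)
      then show ?case
        using \<sigma> unfolding B_def null_admissible_def limitin_def by blast
    qed
    then show "limitin T \<sigma> \<one>\<^bsub>X\<^esub> sequentially"
      unfolding limitin_def using tT one
      by (auto simp: T_def openin_topology_generated_by_iff)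
  qed
  then have "is_finest_null_admissible X T"
    using fine by (auto simp: is_finest_null_admissible_def)
  then show ?thesis
    by (metis finest_null_admissible_unique theI)
qed

lemma topological_group_product:
  assumes G: "\<And>i. i \<in> I \<Longrightarrow> topological_group (G i)"
  shows "topological_group (product_top_group I G)"
proof -
  let ?P = "product_group I G" and ?T = "product_topology (\<lambda>i. topol (G i)) I"
  let ?X = "product_top_group I G"
  have g: "group (G i)" and ts: "topspace (topol (G i)) = carrier (G i)"
    and m: "continuous_map (prod_topology (topol (G i)) (topol (G i))) (topol (G i)) (\<lambda>(x, y). x \<otimes>\<^bsub>G i\<^esub> y)"
    and iv: "continuous_map (topol (G i)) (topol (G i)) (m_inv (G i))" if "i \<in> I" for i
    using G[OF that] by (auto simp: topological_group_def)
  have grp: "group ?X"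
    using product_group[of I G, OF g] group_cong[of ?X ?P]
    by (simp add: product_top_group_def)
  have tsp: "topspace ?T = carrier ?P"
    by (auto simp: ts PiE_iff)
  have inv_eq: "m_inv ?X f = (\<lambda>i\<in>I. inv\<^bsub>G i\<^esub> f i)" if "f \<in> carrier ?P" for f
  proof -
    have "m_inv ?X f = m_inv ?P f"
      by (simp add: m_inv_def product_top_group_def)
    then show ?thesis using inv_product_group[of f I G] that g by simp
  qed
  have "continuous_map ?T ?T (\<lambda>f. \<lambda>i\<in>I. inv\<^bsub>G i\<^esub> f i)"
    unfolding continuous_map_componentwise
  proof (intro conjI ballI)
    fix k assume k: "k \<in> I"
    show "continuous_map ?T (topol (G k)) (\<lambda>x. (\<lambda>i\<in>I. inv\<^bsub>G i\<^esub> x i) k)"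
      using continuous_map_compose[OF continuous_map_product_projection[OF k, of "\<lambda>i. topol (G i)"]
          iv[OF k]] k
      by (simp add: o_def)
  qed auto
  then have ivc: "continuous_map ?T ?T (m_inv ?X)"
    by (rule continuous_map_eq) (use inv_eq tsp in auto)
  have "continuous_map (prod_topology ?T ?T) ?T (\<lambda>p. \<lambda>i\<in>I. fst p i \<otimes>\<^bsub>G i\<^esub> snd p i)"
    unfolding continuous_map_componentwise
  proof (intro conjI ballI)
    fix k assume k: "k \<in> I"
    have "continuous_map (prod_topology ?T ?T) (prod_topology (topol (G k)) (topol (G k)))
        (\<lambda>p. (fst p k, snd p k))"
      by (intro continuous_map_pairedI
           continuous_map_compose[OF continuous_map_fst continuous_map_product_projection[OF k, of "\<lambda>i. topol (G i)"], unfolded o_def]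
           continuous_map_compose[OF continuous_map_snd continuous_map_product_projection[OF k, of "\<lambda>i. topol (G i)"], unfolded o_def])
    from continuous_map_compose[OF this m[OF k]] k
    show "continuous_map (prod_topology ?T ?T) (topol (G k)) (\<lambda>p. (\<lambda>i\<in>I. fst p i \<otimes>\<^bsub>G i\<^esub> snd p i) k)"
      by (simp add: o_def)
  qed auto
  then have mc: "continuous_map (prod_topology ?T ?T) ?T (\<lambda>(x, y). x \<otimes>\<^bsub>?X\<^esub> y)"
    by (simp add: product_top_group_def case_prod_unfold)
  show ?thesis
    unfolding topological_group_def
    using grp tsp ivc mc by (simp add: product_top_group_def)
qed

lemma inv_restrict_top_group:
  assumes "group X" "subgroup H X" "x \<in> H"
  shows "m_inv (restrict_top_group X H) x = m_inv X x"
proof -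
  have "m_inv (restrict_top_group X H) x = m_inv (X\<lparr>carrier := H\<rparr>) x"
    by (simp add: m_inv_def restrict_top_group_def)
  then show ?thesis
    using group.m_inv_consistent[OF assms] by simp
qed

lemma topological_group_restrict:
  assumes X: "topological_group X" and H: "subgroup H X"
  shows "topological_group (restrict_top_group X H)"
proof -
  let ?T = "topol X"
  have g: "group X" and ts: "topspace ?T = carrier X"
    and m: "continuous_map (prod_topology ?T ?T) ?T (\<lambda>(x, y). x \<otimes>\<^bsub>X\<^esub> y)"
    and iv: "continuous_map ?T ?T (m_inv X)"
    using X by (auto simp: topological_group_def)
  have HX: "H \<subseteq> carrier X" using H by (rule subgroup.subset)
  have "group (X\<lparr>carrier := H\<rparr>)"
    using group.subgroup_imp_group[OF g H] .
  then have grp: "group (restrict_top_group X H)"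
    using group_cong[of "restrict_top_group X H" "X\<lparr>carrier := H\<rparr>"]
    by (simp add: restrict_top_group_def)
  have "continuous_map (subtopology ?T H) (subtopology ?T H) (m_inv X)"
    unfolding continuous_map_in_subtopology
    using continuous_map_from_subtopology[OF iv] H by (auto simp: subgroup.m_inv_closed)
  then have ivc: "continuous_map (subtopology ?T H) (subtopology ?T H) (m_inv (restrict_top_group X H))"
    by (rule continuous_map_eq) (use inv_restrict_top_group[OF g H] in auto)
  have mc: "continuous_map (prod_topology (subtopology ?T H) (subtopology ?T H)) (subtopology ?T H)
      (\<lambda>(x, y). x \<otimes>\<^bsub>X\<^esub> y)"
    unfolding continuous_map_in_subtopology subtopology_Times[symmetric]
    using continuous_map_from_subtopology[OF m] H by (auto simp: subgroup.m_closed)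
  show ?thesis
    unfolding topological_group_def
    using grp ivc mc HX ts by (auto simp: restrict_top_group_def)
qed

lemma subgroup_closure_of:
  assumes X: "topological_group X" and H: "subgroup H X"
  shows "subgroup (topol X closure_of H) X"
proof -
  let ?T = "topol X"
  have g: "group X" and ts: "topspace ?T = carrier X"
    and m: "continuous_map (prod_topology ?T ?T) ?T (\<lambda>(x, y). x \<otimes>\<^bsub>X\<^esub> y)"
    and iv: "continuous_map ?T ?T (m_inv X)"
    using X by (auto simp: topological_group_def)
  have HX: "H \<subseteq> topspace ?T" using subgroup.subset[OF H] ts by simp
  show ?thesis
  proof (rule group.subgroupI[OF g])
    show "?T closure_of H \<subseteq> carrier X"
      using closure_of_subset_topspace ts by metis
    show "?T closure_of H \<noteq> {}"
      using closure_of_subset[OF HX] subgroup.one_closed[OF H] by auto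
    show "inv\<^bsub>X\<^esub> a \<in> ?T closure_of H" if "a \<in> ?T closure_of H" for a
    proof -
      have "inv\<^bsub>X\<^esub> a \<in> ?T closure_of (m_inv X ` H)"
        using continuous_map_image_closure_subset[OF iv, of H] that by auto
      moreover have "m_inv X ` H \<subseteq> H"
        using subgroup.m_inv_closed[OF H] by auto
      ultimately show ?thesis using closure_of_mono by blast
    qed
    show "a \<otimes>\<^bsub>X\<^esub> b \<in> ?T closure_of H" if "a \<in> ?T closure_of H" "b \<in> ?T closure_of H" for a b
    proof -
      have "(a, b) \<in> prod_topology ?T ?T closure_of (H \<times> H)"
        using that by (simp add: closure_of_Times)
      then have "a \<otimes>\<^bsub>X\<^esub> b \<in> ?T closure_of ((\<lambda>(x, y). x \<otimes>\<^bsub>X\<^esub> y) ` (H \<times> H))"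
        using continuous_map_image_closure_subset[OF m, of "H \<times> H"] by force
      moreover have "(\<lambda>(x, y). x \<otimes>\<^bsub>X\<^esub> y) ` (H \<times> H) \<subseteq> H"
        using subgroup.m_closed[OF H] by auto
      ultimately show ?thesis using closure_of_mono by blast
    qed
  qed
qed

lemma continuous_hom_compose:
  "f \<in> continuous_hom X Y \<Longrightarrow> g \<in> continuous_hom Y Z \<Longrightarrow> g \<circ> f \<in> continuous_hom X Z"
  unfolding continuous_hom_def using hom_compose continuous_map_compose by blast

lemma subgroup_hom_image:
  assumes "group X" "group Y" "f \<in> hom X Y"
  shows "subgroup (f ` carrier X) Y"
  using group_hom.img_is_subgroup[of X Y f] assms
  by (simp add: group_hom_def group_hom_axioms_def)

lemma compact_group_bohr_product: "compact_group (bohr_product X)"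
proof -
  have *: "topological_group (fst k)" "Hausdorff_space (topol (fst k))" "compact_space (topol (fst k))"
    if "k \<in> bohr_index X" for k
    using that by (auto simp: bohr_index_def compact_group_def hausdorff_group_def)
  then show ?thesis
    using topological_group_product[of "bohr_index X" fst]
    unfolding compact_group_def hausdorff_group_def bohr_product_def
    by (simp add: product_top_group_def Hausdorff_space_product_topology compact_space_product_topology)
qed

lemma bohr_map_product:
  assumes X: "topological_group X"
  shows "bohr_map X \<in> continuous_hom X (bohr_product X)"
proof -
  have f: "snd k \<in> hom X (fst k)" "continuous_map (topol X) (topol (fst k)) (snd k)"
    if "k \<in> bohr_index X" for k
    using that by (auto simp: bohr_index_def continuous_hom_def)
  have mem: "bohr_map X x \<in> carrier (bohr_product X)" if "x \<in> carrier X" for x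
    using f(1) that by (auto simp: bohr_map_def bohr_product_def product_top_group_def hom_def Pi_iff)
  have "bohr_map X \<in> hom X (bohr_product X)"
  proof (rule homI)
    show "bohr_map X (x \<otimes>\<^bsub>X\<^esub> y) = bohr_map X x \<otimes>\<^bsub>bohr_product X\<^esub> bohr_map X y"
      if "x \<in> carrier X" "y \<in> carrier X" for x y
      using that f(1)
      by (auto simp: bohr_map_def bohr_product_def product_top_group_def hom_def intro!: restrict_ext)
  qed (rule mem)
  moreover have "continuous_map (topol X) (product_topology (\<lambda>i. topol (fst i)) (bohr_index X)) (bohr_map X)"
    unfolding continuous_map_componentwise
    using f(2) by (auto simp: bohr_map_def)
  ultimately show ?thesis
    by (simp add: continuous_hom_def bohr_product_def product_top_group_def)
qed

lemma compact_group_closure: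
  assumes K: "compact_group K" and H: "subgroup H K"
  shows "compact_group (restrict_top_group K (topol K closure_of H))"
proof -
  have "topological_group K" "Hausdorff_space (topol K)" "compact_space (topol K)"
    using K by (auto simp: compact_group_def hausdorff_group_def)
  then show ?thesis
    using topological_group_restrict[OF _ subgroup_closure_of[OF _ H]]
    unfolding compact_group_def hausdorff_group_def
    by (simp add: restrict_top_group_def Hausdorff_space_subtopology closedin_compact_space
        compact_space_subtopology)
qed

lemma bohr_image_subgroup:
  assumes X: "topological_group X"
  shows "subgroup (bohr_map X ` carrier X) (bohr_product X)"
  using subgroup_hom_image[of X "bohr_product X" "bohr_map X"] bohr_map_product[OF X]
    compact_group_bohr_product[of X] X
  by (auto simp: continuous_hom_def compact_group_def hausdorff_group_def topological_group_def)

lemma compact_group_bohr_compactification: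
  assumes "topological_group X"
  shows "compact_group (bohr_compactification X)"
  unfolding bohr_compactification_def
  by (rule compact_group_closure[OF compact_group_bohr_product bohr_image_subgroup[OF assms]])

lemma continuous_hom_into_closure:
  assumes f: "f \<in> continuous_hom X K" and "topological_group X" "topological_group K"
  shows "f \<in> continuous_hom X (restrict_top_group K (topol K closure_of (f ` carrier X)))"
proof -
  have "f ` carrier X \<subseteq> topspace (topol K)"
    using assms by (auto simp: continuous_hom_def hom_def topological_group_def)
  then have "f ` carrier X \<subseteq> topol K closure_of (f ` carrier X)"
    by (rule closure_of_subset)
  then show ?thesis
    using assms by (auto simp: continuous_hom_def hom_def restrict_top_group_def
        continuous_map_in_subtopology topological_group_def)
qed

lemma bohr_map_continuous_hom:
  assumes "topological_group X"
  shows "bohr_map X \<in> continuous_hom X (bohr_compactification X)"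
  unfolding bohr_compactification_def
  using continuous_hom_into_closure[OF bohr_map_product[OF assms] assms] compact_group_bohr_product[of X]
  by (auto simp: compact_group_def hausdorff_group_def)

lemma bohr_map_dense:
  assumes "topological_group X"
  shows "topol (bohr_compactification X) closure_of (bohr_map X ` carrier X)
         = carrier (bohr_compactification X)"
proof -
  let ?T = "topol (bohr_product X)" and ?A = "bohr_map X ` carrier X"
  have "?A \<subseteq> topspace ?T"
    using bohr_image_subgroup[OF assms] compact_group_bohr_product[of X] subgroup.subset
    by (fastforce simp: compact_group_def hausdorff_group_def topological_group_def)
  then have "?A \<subseteq> ?T closure_of ?A"
    by (rule closure_of_subset)
  then show ?thesis
    by (simp add: bohr_compactification_def restrict_top_group_def closure_of_subtopology
        Int_absorb1 inf.absorb2)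
qed

text \<open>Transport of a topological group structure along an injection; this is how a compact
  group on an arbitrary type is moved to \<^typ>\<open>'a set set\<close>.\<close>

lemma transport_compact_group:
  fixes h :: "'c \<Rightarrow> 'b" and D :: "'c top_group"
  assumes D: "compact_group D" and h: "inj_on h (carrier D)"
  obtains K :: "'b top_group" and g :: "'b \<Rightarrow> 'c"
  where "compact_group K" "h \<in> continuous_hom D K" "g \<in> continuous_hom K D"
    "\<And>x. x \<in> carrier D \<Longrightarrow> g (h x) = x"
proof -
  let ?T = "topol D"
  define g where "g = inv_into (carrier D) h"
  have gh: "g (h x) = x" if "x \<in> carrier D" for x
    using that h by (simp add: g_def)
  define K where "K = \<lparr>carrier = h ` carrier D, monoid.mult = (\<lambda>a b. h (g a \<otimes>\<^bsub>D\<^esub> g b)),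
    one = h \<one>\<^bsub>D\<^esub>, topol = pullback_topology (h ` carrier D) g ?T\<rparr>"
  have g: "group D" and ts: "topspace ?T = carrier D"
    and m: "continuous_map (prod_topology ?T ?T) ?T (\<lambda>(x, y). x \<otimes>\<^bsub>D\<^esub> y)"
    and iv: "continuous_map ?T ?T (m_inv D)"
    and HD: "Hausdorff_space ?T" and CD: "compact_space ?T"
    using D by (auto simp: compact_group_def hausdorff_group_def topological_group_def)
  interpret D: group D by (rule g)
  have tK: "topspace (topol K) = carrier K"
    using gh ts by (auto simp: K_def topspace_pullback_topology)
  have cg: "continuous_map (topol K) ?T g"
    using continuous_map_pullback[of ?T ?T id] by (simp add: K_def)
  have ch: "continuous_map ?T (topol K) h"
    unfolding K_def top_group.simps
  proof (rule continuous_map_pullback')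
    show "continuous_map ?T ?T (g \<circ> h)"
      by (rule continuous_map_eq[OF continuous_map_id]) (use gh ts in auto)
  qed (use ts in auto)
  have grp: "group K"
  proof (rule groupI)
    fix x assume "x \<in> carrier K"
    then obtain a where a: "a \<in> carrier D" "x = h a" by (auto simp: K_def)
    show "\<exists>y\<in>carrier K. y \<otimes>\<^bsub>K\<^esub> x = \<one>\<^bsub>K\<^esub>"
      by (rule bexI[of _ "h (inv\<^bsub>D\<^esub> a)"]) (use a gh in \<open>auto simp: K_def\<close>)
  qed (use gh in \<open>auto simp: K_def D.m_assoc\<close>)
  have invK: "m_inv K x = h (inv\<^bsub>D\<^esub> (g x))" if "x \<in> carrier K" for x
    by (rule group.inv_equality[OF grp]) (use that gh in \<open>auto simp: K_def\<close>)
  have "continuous_map (topol K) (topol K) (h \<circ> (m_inv D \<circ> g))"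
    by (intro continuous_map_compose[OF _ ch] continuous_map_compose[OF cg iv])
  then have ivK: "continuous_map (topol K) (topol K) (m_inv K)"
    by (rule continuous_map_eq) (use invK tK in auto)
  have "continuous_map (prod_topology (topol K) (topol K)) (prod_topology ?T ?T) (\<lambda>p. (g (fst p), g (snd p)))"
    by (intro continuous_map_pairedI continuous_map_compose[OF continuous_map_fst cg, unfolded o_def]
          continuous_map_compose[OF continuous_map_snd cg, unfolded o_def])
  from continuous_map_compose[OF continuous_map_compose[OF this m] ch]
  have mK: "continuous_map (prod_topology (topol K) (topol K)) (topol K) (\<lambda>(x, y). x \<otimes>\<^bsub>K\<^esub> y)"
    by (simp add: o_def case_prod_unfold K_def)
  have "Hausdorff_space (topol K)"
    by (rule Hausdorff_space_injective_preimage[OF HD cg]) (use tK gh in \<open>auto simp: K_def inj_on_def\<close>)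
  moreover have "compact_space (topol K)"
  proof -
    have "compactin (topol K) (h ` topspace ?T)"
      using CD ch image_compactin unfolding compact_space_def by blast
    then show ?thesis
      using tK ts by (simp add: compact_space_def K_def)
  qed
  ultimately have "compact_group K"
    using grp tK ivK mK by (simp add: compact_group_def hausdorff_group_def topological_group_def)
  moreover have "h \<in> continuous_hom D K"
    using ch gh by (auto simp: continuous_hom_def hom_def K_def)
  moreover have "g \<in> continuous_hom K D"
    using cg gh by (auto simp: continuous_hom_def hom_def K_def)
  ultimately show ?thesis
    using gh that by blast
qed

theorem bohr_universal:
  fixes X :: "'a top_group" and C :: "'c top_group"
  assumes X: "topological_group X" and C: "compact_group C" and f: "f \<in> continuous_hom X C"
  shows "\<exists>g. g \<in> continuous_hom (bohr_compactification X) C \<and> (\<forall>x\<in>carrier X. g (bohr_map X x) = f x)"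
    and "\<And>g g'. \<lbrakk>g \<in> continuous_hom (bohr_compactification X) C; \<forall>x\<in>carrier X. g (bohr_map X x) = f x;
      g' \<in> continuous_hom (bohr_compactification X) C; \<forall>x\<in>carrier X. g' (bohr_map X x) = f x\<rbrakk>
      \<Longrightarrow> \<forall>p\<in>carrier (bohr_compactification X). g p = g' p"
proof -
  let ?S = "topol C closure_of (f ` carrier X)"
  define D where "D = restrict_top_group C ?S"
  have tC: "topological_group C" and HC: "Hausdorff_space (topol C)"
    using C by (auto simp: compact_group_def hausdorff_group_def)
  have "subgroup (f ` carrier X) C"
    using subgroup_hom_image X tC f by (auto simp: topological_group_def continuous_hom_def)
  then have cD: "compact_group D"
    unfolding D_def using compact_group_closure C by blast
  have fD: "f \<in> continuous_hom X D"
    unfolding D_def using continuous_hom_into_closure f X tC by blast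
  have carD: "carrier D = ?S" by (simp add: D_def restrict_top_group_def)
  define h where "h = (\<lambda>y. {A. A \<subseteq> carrier X \<and> y \<in> topol C closure_of (f ` A)})"
  have "inj_on h ?S"
  proof (rule inj_onI, rule ccontr)
    fix y z assume y: "y \<in> ?S" and z: "z \<in> ?S" and eq: "h y = h z" and "y \<noteq> z"
    then obtain U V where UV: "openin (topol C) U" "openin (topol C) V" "y \<in> U" "z \<in> V" "disjnt U V"
      using HC unfolding Hausdorff_space_def by (meson in_closure_of)
    let ?A = "{x \<in> carrier X. f x \<in> U}"
    have "y \<in> topol C closure_of (f ` ?A)"
      unfolding in_closure_of
    proof (intro conjI allI impI)
      show "y \<in> topspace (topol C)" using y by (simp add: in_closure_of)
      fix W assume "y \<in> W \<and> openin (topol C) W"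
      then have "y \<in> W \<inter> U" "openin (topol C) (W \<inter> U)" using UV by auto
      then obtain c where "c \<in> f ` carrier X" "c \<in> W \<inter> U"
        using y unfolding in_closure_of by blast
      then show "\<exists>c. c \<in> f ` ?A \<and> c \<in> W" by auto
    qed
    then have "?A \<in> h z" using eq by (auto simp: h_def)
    then have "z \<in> topol C closure_of (f ` ?A)" by (simp add: h_def)
    then obtain c where "c \<in> f ` ?A" "c \<in> V"
      using UV unfolding in_closure_of by blast
    then show False using UV by (auto simp: disjnt_iff)
  qed
  then obtain K g where K: "compact_group K" and h: "h \<in> continuous_hom D K" and g: "g \<in> continuous_hom K D"
    and gh: "\<And>x. x \<in> carrier D \<Longrightarrow> g (h x) = x"
    using transport_compact_group[OF cD, of h] carD by metis
  let ?k = "(K, h \<circ> f)"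
  have "h \<circ> f \<in> continuous_hom X K"
    using continuous_hom_compose[OF fD h] .
  then have k: "?k \<in> bohr_index X"
    using K by (simp add: bohr_index_def)
  have cpr: "(\<lambda>p. p ?k) \<in> continuous_hom (bohr_compactification X) K"
  proof -
    have "continuous_map (topol (bohr_product X)) (topol K) (\<lambda>p. p ?k)"
      using continuous_map_product_projection[OF k, of "\<lambda>k. topol (fst k)"]
      by (simp add: bohr_product_def product_top_group_def)
    moreover have "carrier (bohr_compactification X) \<subseteq> carrier (bohr_product X)"
      using closure_of_subset_topspace[of "topol (bohr_product X)"] compact_group_bohr_product[of X]
      by (simp add: bohr_compactification_def restrict_top_group_def compact_group_def
          hausdorff_group_def topological_group_def)
    then have "(\<lambda>p. p ?k) \<in> hom (bohr_compactification X) K"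
      using k by (fastforce simp: hom_def bohr_compactification_def restrict_top_group_def bohr_product_def
          product_top_group_def PiE_iff)
    ultimately show ?thesis
      by (simp add: continuous_hom_def bohr_compactification_def restrict_top_group_def
          continuous_map_from_subtopology)
  qed
  have DC: "id \<in> continuous_hom D C"
  proof -
    have "?S \<subseteq> carrier C"
      using closure_of_subset_topspace[of "topol C" "f ` carrier X"] tC
      by (simp add: topological_group_def)
    then have "id \<in> hom D C"
      unfolding D_def restrict_top_group_def hom_def by (simp add: Pi_iff subset_iff)
    then show ?thesis
      by (simp add: continuous_hom_def D_def restrict_top_group_def id_def
          continuous_map_from_subtopology)
  qed
  have "(\<lambda>p. g (p ?k)) \<in> continuous_hom (bohr_compactification X) C"
    using continuous_hom_compose[OF continuous_hom_compose[OF cpr g] DC] by (simp add: o_def)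
  moreover have "g (bohr_map X x ?k) = f x" if "x \<in> carrier X" for x
    using that k gh fD by (auto simp: bohr_map_def continuous_hom_def hom_def)
  ultimately show "\<exists>g. g \<in> continuous_hom (bohr_compactification X) C \<and> (\<forall>x\<in>carrier X. g (bohr_map X x) = f x)"
    by blast
  fix u v assume uv: "u \<in> continuous_hom (bohr_compactification X) C" "\<forall>x\<in>carrier X. u (bohr_map X x) = f x"
      "v \<in> continuous_hom (bohr_compactification X) C" "\<forall>x\<in>carrier X. v (bohr_map X x) = f x"
  show "\<forall>p\<in>carrier (bohr_compactification X). u p = v p"
  proof
    fix p assume "p \<in> carrier (bohr_compactification X)"
    then have "p \<in> topol (bohr_compactification X) closure_of (bohr_map X ` carrier X)"
      using bohr_map_dense[OF X] by simp
    then show "u p = v p"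
      by (rule forall_in_closure_of_eq[OF _ HC]) (use uv in \<open>auto simp: continuous_hom_def\<close>)
  qed
qed

end

theory Submission
  imports Defs "HOL-Algebra.Weak_Morphisms"
begin

text \<open>The group \<open>s(X)\<close> depends only on the null sequences of \<open>X\<close> and has the same null sequences as
  \<open>X\<close>, while the Schur property says that \<open>X\<close> and \<open>X\<^sup>+\<close> have the same null sequences; this gives
  (1) and (2). A homomorphism from an s-group that preserves null sequences is continuous, which
  gives (4).

  The strict inclusions in (3) are witnessed by countable groups, which live on every infinite type.
  The discrete affine group of the rationals is an s-group that is not MAP. The
  group of finite sets of natural numbers under symmetric difference, with its Bohr topology, has the
  Schur property because taking the Bohr topology is idempotent; its null sequences are eventually
  trivial although it is not discrete, so it is not an s-group.\<close>

section \<open>Topological groups and null sequences\<close>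

lemma topological_groupD:
  assumes "topological_group X"
  shows "group X" "topspace (topol X) = carrier X"
    "continuous_map (prod_topology (topol X) (topol X)) (topol X) (\<lambda>(x, y). x \<otimes>\<^bsub>X\<^esub> y)"
    "continuous_map (topol X) (topol X) (m_inv X)"
  using assms by (auto simp: topological_group_def)

lemma hausdorff_groupD:
  assumes "hausdorff_group X"
  shows "topological_group X" "group X" "topspace (topol X) = carrier X" "Hausdorff_space (topol X)"
  using assms by (auto simp: hausdorff_group_def topological_group_def)

lemma continuous_map_mult:
  assumes X: "topological_group X" and f: "continuous_map T (topol X) f"
    and g: "continuous_map T (topol X) g"
  shows "continuous_map T (topol X) (\<lambda>x. f x \<otimes>\<^bsub>X\<^esub> g x)"
  using continuous_map_compose[OF continuous_map_pairedI[OF f g] topological_groupD(3)[OF X]]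
  by (simp add: o_def)

lemma continuous_map_inverse:
  assumes X: "topological_group X" and f: "continuous_map T (topol X) f"
  shows "continuous_map T (topol X) (\<lambda>x. inv\<^bsub>X\<^esub> f x)"
  using continuous_map_compose[OF f topological_groupD(4)[OF X]] by (simp add: o_def)

lemma continuous_map_pullback_self: "continuous_map (pullback_topology A f T) T f"
  using continuous_map_pullback[OF continuous_map_id] by (metis id_comp)

text \<open>Continuity into a pullback topology can be tested after composing with \<open>f\<close>,
  and \<open>f\<close> turns the operations of \<open>X\<close> into those of \<open>K\<close>. This
  yields both the Bohr topology and the graph topology in
  \<open>continuous_hom_from_s_group\<close>.\<close>

lemma topological_group_pullback:
  assumes X: "group X" and K: "topological_group K" and f: "f \<in> hom X K"
  shows "topological_group (X\<lparr>topol := pullback_topology (carrier X) f (topol K)\<rparr>)"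
proof -
  let ?T = "pullback_topology (carrier X) f (topol K)"
  interpret X: group X by (rule X)
  interpret f: group_hom X K f
    using X K f by (simp add: group_hom_def group_hom_axioms_def topological_groupD)
  have ts: "topspace ?T = carrier X"
    using f.hom_closed topological_groupD(2)[OF K] by (auto simp: topspace_pullback_topology)
  have cf: "continuous_map ?T (topol K) f"
    by (rule continuous_map_pullback_self)
  have "continuous_map ?T ?T (m_inv X)"
  proof (rule continuous_map_pullback')
    show "continuous_map ?T (topol K) (f \<circ> m_inv X)"
      by (rule continuous_map_eq[OF continuous_map_inverse[OF K cf]]) (simp add: ts)
  qed (use ts in auto)
  moreover have "continuous_map (prod_topology ?T ?T) ?T (\<lambda>(x, y). x \<otimes>\<^bsub>X\<^esub> y)"
  proof (rule continuous_map_pullback')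
    have "continuous_map (prod_topology ?T ?T) (topol K) (\<lambda>p. f (fst p) \<otimes>\<^bsub>K\<^esub> f (snd p))"
      by (intro continuous_map_mult[OF K] continuous_map_compose[OF continuous_map_fst cf, unfolded o_def]
          continuous_map_compose[OF continuous_map_snd cf, unfolded o_def])
    then show "continuous_map (prod_topology ?T ?T) (topol K) (f \<circ> (\<lambda>(x, y). x \<otimes>\<^bsub>X\<^esub> y))"
      by (rule continuous_map_eq) (auto simp: ts)
  qed (use ts in auto)
  ultimately show ?thesis
    using X ts by (simp add: topological_group_def)
qed

lemma null_seqs_hom:
  assumes f: "f \<in> hom X Y" and "continuous_map (topol X) (topol Y) f" "group X" "group Y"
    and \<sigma>: "\<sigma> \<in> null_seqs X"
  shows "f \<circ> \<sigma> \<in> null_seqs Y"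
proof -
  have "f \<one>\<^bsub>X\<^esub> = \<one>\<^bsub>Y\<^esub>"
    using assms by (simp add: hom_one)
  then show ?thesis
    using assms continuous_map_limit[of "topol X" "topol Y" f \<sigma> "\<one>\<^bsub>X\<^esub>" sequentially]
    by (auto simp: null_seqs_def hom_def)
qed

section \<open>Convergent sequences as translates of null sequences\<close>

lemma limitin_coarser:
  assumes "limitin T \<sigma> l F" "topspace S = topspace T" "\<And>U. openin S U \<Longrightarrow> openin T U"
  shows "limitin S \<sigma> l F"
  using assms by (auto simp: limitin_def)

lemma limitin_translate:
  assumes X: "topological_group X" and \<sigma>: "limitin (topol X) \<sigma> l F" and a: "a \<in> carrier X"
  shows "limitin (topol X) (\<lambda>n. a \<otimes>\<^bsub>X\<^esub> \<sigma> n) (a \<otimes>\<^bsub>X\<^esub> l) F"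
proof -
  have "continuous_map (topol X) (topol X) (\<lambda>x. a \<otimes>\<^bsub>X\<^esub> x)"
    by (intro continuous_map_mult[OF X]) (use a topological_groupD(2)[OF X] in auto)
  then show ?thesis
    using continuous_map_limit[OF _ \<sigma>] by (fastforce simp: o_def)
qed

text \<open>Left translations by \<open>l\<close> and by its inverse are continuous, so convergence
  to \<open>l\<close> can be moved to the unit and back.\<close>

lemma convergent_seqs_iff_translate_null:
  assumes X: "topological_group X"
  shows "\<sigma> \<in> convergent_seqs X \<longleftrightarrow> range \<sigma> \<subseteq> carrier X \<and>
    (\<exists>l\<in>carrier X. (\<lambda>n. inv\<^bsub>X\<^esub> l \<otimes>\<^bsub>X\<^esub> \<sigma> n) \<in> null_seqs X)"
proof -
  interpret group X using X by (rule topological_groupD)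
  have "limitin (topol X) \<sigma> l sequentially \<longleftrightarrow> (\<lambda>n. inv\<^bsub>X\<^esub> l \<otimes>\<^bsub>X\<^esub> \<sigma> n) \<in> null_seqs X"
    if l: "l \<in> carrier X" and s: "range \<sigma> \<subseteq> carrier X" for l
  proof
    assume "limitin (topol X) \<sigma> l sequentially"
    from limitin_translate[OF X this inv_closed[OF l]]
    show "(\<lambda>n. inv\<^bsub>X\<^esub> l \<otimes>\<^bsub>X\<^esub> \<sigma> n) \<in> null_seqs X"
      using l s by (auto simp: null_seqs_def)
  next
    assume "(\<lambda>n. inv\<^bsub>X\<^esub> l \<otimes>\<^bsub>X\<^esub> \<sigma> n) \<in> null_seqs X"
    then have "limitin (topol X) (\<lambda>n. inv\<^bsub>X\<^esub> l \<otimes>\<^bsub>X\<^esub> \<sigma> n) \<one>\<^bsub>X\<^esub> sequentially"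
      by (simp add: null_seqs_def)
    from limitin_translate[OF X this l] show "limitin (topol X) \<sigma> l sequentially"
      using l s by (simp add: m_assoc[symmetric] range_subsetD)
  qed
  moreover have "l \<in> carrier X" if "limitin (topol X) \<sigma> l sequentially" for l
    using limitin_topspace[OF that] topological_groupD(2)[OF X] by simp
  ultimately show ?thesis
    unfolding convergent_seqs_def by blast
qed

text \<open>\<open>convergent_seqs\<close> does not record limits. Null sequences determine it by
  translation. Conversely, a limit in the finer topology is also a limit in the Hausdorff topology
  \<open>T\<close>, so the two limits of a sequence agree.\<close>

lemma convergent_seqs_eq_iff_null_seqs_eq:
  assumes X: "topological_group X" and Y: "hausdorff_group (X\<lparr>topol := T\<rparr>)"
    and coarser: "\<And>U. openin T U \<Longrightarrow> openin (topol X) U"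
  shows "convergent_seqs X = convergent_seqs (X\<lparr>topol := T\<rparr>) \<longleftrightarrow>
    null_seqs X = null_seqs (X\<lparr>topol := T\<rparr>)"
proof
  let ?Y = "X\<lparr>topol := T\<rparr>"
  assume "null_seqs X = null_seqs ?Y"
  then show "convergent_seqs X = convergent_seqs ?Y"
    using convergent_seqs_iff_translate_null[OF X]
      convergent_seqs_iff_translate_null[OF hausdorff_groupD(1)[OF Y]] by auto
next
  let ?Y = "X\<lparr>topol := T\<rparr>"
  assume eq: "convergent_seqs X = convergent_seqs ?Y"
  have ts: "topspace T = topspace (topol X)" and H: "Hausdorff_space T"
    using topological_groupD(2)[OF X] hausdorff_groupD(3,4)[OF Y] by simp_all
  show "null_seqs X = null_seqs ?Y"
  proof (intro equalityI subsetI)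
    fix \<sigma> assume "\<sigma> \<in> null_seqs X"
    then show "\<sigma> \<in> null_seqs ?Y"
      using limitin_coarser[OF _ ts coarser] by (auto simp: null_seqs_def)
  next
    fix \<sigma> assume \<sigma>: "\<sigma> \<in> null_seqs ?Y"
    then have "\<sigma> \<in> convergent_seqs X"
      unfolding eq by (auto simp: null_seqs_def convergent_seqs_def)
    then obtain l where l: "limitin (topol X) \<sigma> l sequentially"
      by (auto simp: convergent_seqs_def)
    have "l = \<one>\<^bsub>X\<^esub>"
      using limitin_Hausdorff_unique[OF limitin_coarser[OF l ts coarser] _ _ H] \<sigma>
      by (simp add: null_seqs_def)
    then show "\<sigma> \<in> null_seqs X"
      using l \<sigma> by (simp add: null_seqs_def)
  qed
qed

section \<open>The s-modification\<close>

lemma s_mod_eqI: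
  assumes "is_finest_null_admissible X T"
  shows "s_mod X = X\<lparr>topol := T\<rparr>"
  unfolding s_mod_def using assms finest_null_admissible_unique by (metis the_equality)

lemma s_mod_finest:
  assumes "hausdorff_group X"
  shows "is_finest_null_admissible X (topol (s_mod X))"
  using finest_null_admissible_exists[OF assms] by (simp add: s_mod_def)

lemma null_admissible_self:
  assumes "hausdorff_group X"
  shows "null_admissible X (topol X)"
  using assms by (simp add: null_admissible_def null_seqs_def)

text \<open>The topology of \<open>X\<close> is itself admissible, so the modified topology refines
  it and gains no null sequences; admissibility keeps the old ones.\<close>

lemma null_seqs_s_mod:
  assumes X: "hausdorff_group X"
  shows "null_seqs (s_mod X) = null_seqs X"
proof -
  let ?T = "topol (s_mod X)"
  have adm: "null_admissible X ?T"
    and fine: "\<And>U. openin (topol X) U \<Longrightarrow> openin ?T U"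
    using s_mod_finest[OF X] null_admissible_self[OF X] by (auto simp: is_finest_null_admissible_def)
  have ts: "topspace (topol X) = topspace ?T"
    using adm hausdorff_groupD(3)[OF X] by (simp add: null_admissible_def hausdorff_group_def topological_group_def)
  have "limitin ?T \<sigma> \<one>\<^bsub>X\<^esub> sequentially \<longleftrightarrow> limitin (topol X) \<sigma> \<one>\<^bsub>X\<^esub> sequentially"
    if "range \<sigma> \<subseteq> carrier X" for \<sigma>
    using that adm limitin_coarser[OF _ ts fine] by (auto simp: null_admissible_def null_seqs_def)
  then show ?thesis
    by (auto simp: null_seqs_def s_mod_def)
qed

text \<open>In \<open>s_mod\<close> the topology enters only through
  \<open>null_seqs\<close>.\<close>

lemma s_mod_topol_update:
  assumes "null_seqs (X\<lparr>topol := T\<rparr>) = null_seqs X"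
  shows "s_mod (X\<lparr>topol := T\<rparr>) = s_mod X"
  using assms by (simp add: s_mod_def is_finest_null_admissible_def null_admissible_def)

section \<open>Homomorphisms out of s-groups and the graph topology\<close>

lemma limitin_pullback:
  assumes "limitin T (f \<circ> \<sigma>) (f l) F" "range \<sigma> \<subseteq> A" "l \<in> A"
  shows "limitin (pullback_topology A f T) \<sigma> l F"
proof -
  have "\<sigma> n \<in> A" for n using assms(2) by auto
  then show ?thesis
    using assms by (fastforce simp: limitin_def topspace_pullback_topology openin_pullback_topology)
qed

text \<open>The graph of a homomorphism between groups on different types lives in this binary
  product; \<open>product_top_group\<close> has all factors on one type.\<close>

lemma topological_group_prod:
  assumes X: "topological_group X" and Y: "topological_group Y"
  shows "topological_group \<lparr>carrier = carrier (X \<times>\<times> Y), monoid.mult = monoid.mult (X \<times>\<times> Y),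
    one = one (X \<times>\<times> Y), topol = prod_topology (topol X) (topol Y)\<rparr>" (is "topological_group ?P")
proof -
  let ?T = "prod_topology (topol X) (topol Y)"
  note XY = topological_groupD[OF X] topological_groupD[OF Y]
  have g: "group (X \<times>\<times> Y)"
    using XY by (simp add: DirProd_group)
  then have grp: "group ?P"
    using group_cong[of ?P "X \<times>\<times> Y"] by simp
  have ts: "topspace ?T = carrier (X \<times>\<times> Y)"
    using XY by (simp add: DirProd_def)
  have inv_eq: "m_inv ?P p = (inv\<^bsub>X\<^esub> fst p, inv\<^bsub>Y\<^esub> snd p)" if "p \<in> carrier (X \<times>\<times> Y)" for p
  proof -
    have "m_inv ?P p = m_inv (X \<times>\<times> Y) p"
      by (simp add: m_inv_def)
    then show ?thesis using that XY inv_DirProd[of X Y "fst p" "snd p"] by (auto simp: DirProd_def)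
  qed
  have "continuous_map ?T ?T (\<lambda>p. (inv\<^bsub>X\<^esub> fst p, inv\<^bsub>Y\<^esub> snd p))"
    by (intro continuous_map_pairedI continuous_map_inverse X Y continuous_map_fst continuous_map_snd)
  then have "continuous_map ?T ?T (m_inv ?P)"
    by (rule continuous_map_eq) (use inv_eq ts in auto)
  moreover have "continuous_map (prod_topology ?T ?T) ?T
      (\<lambda>p. (fst (fst p) \<otimes>\<^bsub>X\<^esub> fst (snd p), snd (fst p) \<otimes>\<^bsub>Y\<^esub> snd (snd p)))"
    by (intro continuous_map_pairedI continuous_map_mult X Y
        continuous_map_compose[OF continuous_map_fst, unfolded o_def]
        continuous_map_compose[OF continuous_map_snd, unfolded o_def] continuous_map_fst continuous_map_snd)
  then have "continuous_map (prod_topology ?T ?T) ?T (\<lambda>(p, q). p \<otimes>\<^bsub>?P\<^esub> q)"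
    by (simp add: DirProd_def case_prod_unfold)
  ultimately show ?thesis
    using grp ts by (simp add: topological_group_def)
qed

text \<open>The coarsest topology making both the identity into \<open>X\<close> and
  \<open>f\<close> into \<open>Y\<close> continuous is a Hausdorff group topology in which every
  null sequence of \<open>X\<close> still tends to the unit. The topology of an s-group is the
  finest of this kind, so \<open>f\<close> is continuous for it.\<close>

lemma continuous_hom_from_s_group:
  assumes X: "X \<in> s_groups" and Y: "topological_group Y" and f: "f \<in> hom X Y"
    and null: "\<And>\<sigma>. \<sigma> \<in> null_seqs X \<Longrightarrow> f \<circ> \<sigma> \<in> null_seqs Y"
  shows "continuous_map (topol X) (topol Y) f"
proof -
  have hX: "hausdorff_group X" and sX: "s_mod X = X"
    using X by (auto simp: s_groups_def)
  note XD = hausdorff_groupD[OF hX] and YD = topological_groupD[OF Y]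
  have f1: "f \<one>\<^bsub>X\<^esub> = \<one>\<^bsub>Y\<^esub>"
    using f XD YD by (simp add: hom_one)
  have one: "\<one>\<^bsub>X\<^esub> \<in> carrier X"
    using XD(2) by (simp add: group.is_monoid)
  \<comment> \<open>The pullback of the topology of \<open>Y\<close> along \<open>f\<close> need not be Hausdorff, unlike that of
    the product topology along the graph map.\<close>
  let ?h = "\<lambda>x. (x, f x)" and ?P = "prod_topology (topol X) (topol Y)"
  let ?T = "pullback_topology (carrier X) ?h ?P"
  have ts: "topspace ?T = carrier X"
    using f XD YD by (auto simp: topspace_pullback_topology hom_def)
  have "?h \<in> hom X \<lparr>carrier = carrier (X \<times>\<times> Y), monoid.mult = monoid.mult (X \<times>\<times> Y),
      one = one (X \<times>\<times> Y), topol = ?P\<rparr>"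
    using f by (auto simp: hom_def DirProd_def)
  from topological_group_pullback[OF XD(2) topological_group_prod[OF XD(1) Y] this]
  have tg: "topological_group (X\<lparr>topol := ?T\<rparr>)" by simp
  have ch: "continuous_map ?T ?P ?h"
    by (rule continuous_map_pullback_self)
  have "continuous_map ?T (topol X) id"
    using continuous_map_compose[OF ch continuous_map_fst] by (simp add: o_def id_def)
  from Hausdorff_space_injective_preimage[OF XD(4) this]
  have "hausdorff_group (X\<lparr>topol := ?T\<rparr>)"
    using tg by (simp add: hausdorff_group_def)
  moreover have "limitin ?T \<sigma> \<one>\<^bsub>X\<^esub> sequentially" if "\<sigma> \<in> null_seqs X" for \<sigma>
    using that null[OF that] f1 one
    by (intro limitin_pullback) (auto simp: null_seqs_def limitin_pairwise o_def)
  ultimately have "null_admissible X ?T"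
    by (simp add: null_admissible_def)
  then have "openin (topol X) U" if "openin ?T U" for U
    using s_mod_finest[OF hX] sX that by (simp add: is_finest_null_admissible_def)
  then have "continuous_map (topol X) ?T id"
    using topology_finer_continuous_id[of ?T "topol X"] ts XD by simp
  \<comment> \<open>\<open>f\<close> is the identity into \<open>?T\<close> followed by the graph
    map and the second projection.\<close>
  from continuous_map_compose[OF continuous_map_compose[OF this ch] continuous_map_snd]
  show ?thesis by (simp add: o_def)
qed

section \<open>The Bohr topology\<close>

lemma bohr_map_hom:
  assumes "topological_group X"
  shows "bohr_map X \<in> hom X (bohr_compactification X)"
    and "topological_group (bohr_compactification X)"
  using bohr_map_continuous_hom[OF assms] compact_group_bohr_compactification[OF assms]
  by (auto simp: continuous_hom_def compact_group_def hausdorff_group_def)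

lemma bohr_simps [simp]:
  "carrier (bohr X) = carrier X" "monoid.mult (bohr X) = monoid.mult X" "one (bohr X) = one X"
  "m_inv (bohr X) = m_inv X"
  by (simp_all add: bohr_def)

lemma topological_group_bohr:
  assumes "topological_group X"
  shows "topological_group (bohr X)"
  unfolding bohr_def
  using assms by (intro topological_group_pullback bohr_map_hom topological_groupD)

lemma hausdorff_group_bohr:
  assumes "MAP X"
  shows "hausdorff_group (bohr X)"
  using assms topological_group_bohr[of X] by (simp add: MAP_def hausdorff_group_def)

lemma bohr_topol_coarser:
  assumes X: "topological_group X" and U: "openin (topol (bohr X)) U"
  shows "openin (topol X) U"
proof -
  obtain V where V: "openin (topol (bohr_compactification X)) V" "U = bohr_map X -` V \<inter> carrier X"
    using U by (auto simp: bohr_def openin_pullback_topology)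
  have "continuous_map (topol X) (topol (bohr_compactification X)) (bohr_map X)"
    using bohr_map_continuous_hom[OF X] by (simp add: continuous_hom_def)
  from openin_continuous_map_preimage[OF this V(1)] show ?thesis
    using V(2) topological_groupD(2)[OF X] by (simp add: vimage_def Int_def conj_commute)
qed

text \<open>By the universal property a continuous homomorphism into \<open>C\<close> factors
  through \<open>bohr_map X\<close>, along which the Bohr topology is pulled back. The other
  inclusion holds because the Bohr topology is coarser.\<close>

lemma continuous_hom_bohr_iff:
  assumes X: "topological_group X" and C: "compact_group C"
  shows "continuous_hom (bohr X) C = continuous_hom X C"
proof (intro equalityI subsetI)
  fix f assume f: "f \<in> continuous_hom (bohr X) C"
  have "continuous_map (topol X) (topol (bohr X)) id"
    using topology_finer_continuous_id[of "topol (bohr X)" "topol X"] bohr_topol_coarser[OF X]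
      topological_groupD(2)[OF X] topological_groupD(2)[OF topological_group_bohr[OF X]] by simp
  from continuous_map_compose[OF this, of "topol C" f] f
  show "f \<in> continuous_hom X C"
    by (simp add: continuous_hom_def hom_def)
next
  fix f assume f: "f \<in> continuous_hom X C"
  then obtain g where g: "continuous_map (topol (bohr_compactification X)) (topol C) g"
    "\<forall>x\<in>carrier X. g (bohr_map X x) = f x"
    using bohr_universal(1)[OF X C] by (auto simp: continuous_hom_def)
  have "continuous_map (topol (bohr X)) (topol C) (g \<circ> bohr_map X)"
    using continuous_map_pullback[OF g(1)] by (simp add: bohr_def)
  then have "continuous_map (topol (bohr X)) (topol C) f"
    by (rule continuous_map_eq)
      (use g topological_groupD(2)[OF topological_group_bohr[OF X]] in auto)
  then show "f \<in> continuous_hom (bohr X) C"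
    using f by (simp add: continuous_hom_def hom_def)
qed

text \<open>The construction sees the topology only through the continuous homomorphisms into
  compact groups. These are the same for \<open>X\<close> and \<open>bohr X\<close>, so the index
  sets, and with them all later stages, are literally equal.\<close>

lemma bohr_bohr:
  assumes X: "topological_group X"
  shows "bohr (bohr X) = bohr X"
proof -
  have ind: "bohr_index (bohr X) = bohr_index X"
    using continuous_hom_bohr_iff[OF X] by (auto simp: bohr_index_def)
  have "bohr_map (bohr X) = bohr_map X"
    by (simp add: bohr_map_def ind fun_eq_iff)
  then have "bohr_compactification (bohr X) = bohr_compactification X"
    by (simp add: bohr_compactification_def bohr_product_def ind)
  then show ?thesis
    using \<open>bohr_map (bohr X) = bohr_map X\<close> by (simp add: bohr_def[of "bohr X"]) (simp add: bohr_def)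
qed

lemma MAP_bohr:
  assumes "MAP X"
  shows "MAP (bohr X)"
proof -
  have "topological_group X" using assms by (simp add: MAP_def hausdorff_group_def)
  then show ?thesis
    using hausdorff_group_bohr[OF assms] by (simp add: MAP_def bohr_bohr hausdorff_groupD)
qed

text \<open>A separating homomorphism stays continuous for the Bohr topology and pulls disjoint
  neighbourhoods back to it. The compact groups may live on any type \<open>'b\<close>, such as
  \<open>bool\<close>.\<close>

lemma MAP_I:
  assumes X: "hausdorff_group X"
    and sep: "\<And>x y. x \<in> carrier X \<Longrightarrow> y \<in> carrier X \<Longrightarrow> x \<noteq> y \<Longrightarrow>
      \<exists>(C :: 'b top_group) f. compact_group C \<and> f \<in> continuous_hom X C \<and> f x \<noteq> f y"
  shows "MAP X"
proof -
  note XD = hausdorff_groupD[OF X]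
  have "Hausdorff_space (topol (bohr X))"
    unfolding Hausdorff_space_def
  proof (intro allI impI, elim conjE)
    fix x y assume xy: "x \<in> topspace (topol (bohr X))" "y \<in> topspace (topol (bohr X))" "x \<noteq> y"
    have ts: "topspace (topol (bohr X)) = carrier X"
      using topological_groupD(2)[OF topological_group_bohr[OF XD(1)]] by simp
    obtain C :: "'b top_group" and f where C: "compact_group C" and f: "f \<in> continuous_hom X C"
      and ne: "f x \<noteq> f y"
      using sep xy ts by metis
    have cf: "continuous_map (topol (bohr X)) (topol C) f"
      using f continuous_hom_bohr_iff[OF XD(1) C] by (auto simp: continuous_hom_def)
    have "f x \<in> topspace (topol C)" "f y \<in> topspace (topol C)"
      using cf xy by (auto simp: continuous_map_def)
    then obtain U V where UV: "openin (topol C) U" "openin (topol C) V" "f x \<in> U" "f y \<in> V" "disjnt U V"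
      using ne C by (metis Hausdorff_space_def compact_group_def hausdorff_group_def)
    let ?p = "\<lambda>U. {z \<in> topspace (topol (bohr X)). f z \<in> U}"
    show "\<exists>U V. openin (topol (bohr X)) U \<and> openin (topol (bohr X)) V \<and> x \<in> U \<and> y \<in> V \<and> disjnt U V"
      by (rule exI[of _ "?p U"], rule exI[of _ "?p V"])
        (use UV xy openin_continuous_map_preimage[OF cf] in \<open>auto simp: disjnt_iff\<close>)
  qed
  then show ?thesis using X by (simp add: MAP_def)
qed

section \<open>The Schur property through null sequences\<close>

lemma schur_iff_null_seqs:
  assumes "MAP X"
  shows "X \<in> schur_groups \<longleftrightarrow> null_seqs (bohr X) = null_seqs X"
proof -
  have X: "topological_group X"
    using assms by (simp add: MAP_def hausdorff_groupD)
  have b: "bohr X = X\<lparr>topol := topol (bohr X)\<rparr>"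
    by (simp add: bohr_def)
  have "convergent_seqs X = convergent_seqs (bohr X) \<longleftrightarrow> null_seqs X = null_seqs (bohr X)"
    using convergent_seqs_eq_iff_null_seqs_eq[OF X, of "topol (bohr X)"]
      hausdorff_group_bohr[OF assms] bohr_topol_coarser[OF X] b by metis
  then show ?thesis using assms by (auto simp: schur_groups_def)
qed

text \<open>Null sequences determine \<open>s_mod\<close> and can be recovered from it.\<close>

lemma schur_iff_s_mod_bohr:
  assumes X: "MAP X"
  shows "X \<in> schur_groups \<longleftrightarrow> s_mod (bohr X) = s_mod X"
proof
  assume "X \<in> schur_groups"
  then have "null_seqs (bohr X) = null_seqs X" using schur_iff_null_seqs[OF X] by simp
  then show "s_mod (bohr X) = s_mod X"
    unfolding bohr_def by (rule s_mod_topol_update)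
next
  assume "s_mod (bohr X) = s_mod X"
  then have "null_seqs (bohr X) = null_seqs X"
    using null_seqs_s_mod hausdorff_group_bohr[OF X] X by (metis MAP_def)
  then show "X \<in> schur_groups" using schur_iff_null_seqs[OF X] by simp
qed

section \<open>Compact groups\<close>

text \<open>Pigeonhole: finitely many open sets, each with all its quotients in \<open>U\<close>,
  cover \<open>K\<close>, so two terms of the sequence share one of them.\<close>

lemma compact_group_sequence_quotient:
  assumes K: "compact_group K" and a: "\<And>n :: nat. a n \<in> carrier K"
    and U: "openin (topol K) U" "\<one>\<^bsub>K\<^esub> \<in> U"
  shows "\<exists>m n. m < n \<and> inv\<^bsub>K\<^esub> a m \<otimes>\<^bsub>K\<^esub> a n \<in> U"
proof -
  let ?T = "topol K" and ?q = "\<lambda>p. inv\<^bsub>K\<^esub> fst p \<otimes>\<^bsub>K\<^esub> snd p"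
  have tK: "topological_group K" and cK: "compact_space ?T"
    using K by (auto simp: compact_group_def hausdorff_groupD)
  note KD = topological_groupD[OF tK]
  interpret group K by (rule KD)
  have "continuous_map (prod_topology ?T ?T) ?T ?q"
    by (intro continuous_map_mult continuous_map_inverse tK continuous_map_fst continuous_map_snd)
  from openin_continuous_map_preimage[OF this U(1)]
  have op: "openin (prod_topology ?T ?T) {p \<in> topspace (prod_topology ?T ?T). ?q p \<in> U}" .
  \<comment> \<open>At the diagonal point \<open>(p, p)\<close> the quotient is the unit, which lies
    in \<open>U\<close>. A box around this point inside the preimage of \<open>U\<close> is shrunk
    to a square.\<close>
  have "\<exists>W. openin ?T W \<and> p \<in> W \<and> (\<forall>x\<in>W. \<forall>y\<in>W. inv\<^bsub>K\<^esub> x \<otimes>\<^bsub>K\<^esub> y \<in> U)" if p: "p \<in> carrier K" for p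
  proof -
    have "(p, p) \<in> {p \<in> topspace (prod_topology ?T ?T). ?q p \<in> U}"
      using p U KD by simp
    with op obtain V W where VW: "openin ?T V" "openin ?T W" "p \<in> V" "p \<in> W"
      "V \<times> W \<subseteq> {p \<in> topspace (prod_topology ?T ?T). ?q p \<in> U}"
      unfolding openin_prod_topology_alt by meson
    then show ?thesis by (intro exI[of _ "V \<inter> W"]) auto
  qed
  then obtain W where W: "\<And>p. p \<in> carrier K \<Longrightarrow> openin ?T (W p) \<and> p \<in> W p \<and>
      (\<forall>x\<in>W p. \<forall>y\<in>W p. inv\<^bsub>K\<^esub> x \<otimes>\<^bsub>K\<^esub> y \<in> U)"
    by metis
  then have "\<forall>V\<in>W ` carrier K. openin ?T V" "topspace ?T \<subseteq> \<Union>(W ` carrier K)"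
    using KD(2) by auto
  then obtain F where F: "finite F" "F \<subseteq> W ` carrier K" "topspace ?T \<subseteq> \<Union>F"
    using cK unfolding compact_space_alt by meson
  have "\<exists>V. V \<in> F \<and> a n \<in> V" for n
  proof -
    have "a n \<in> \<Union>F" using subsetD[OF F(3), of "a n"] a KD(2) by simp
    then show ?thesis by blast
  qed
  then obtain v where v: "\<And>n. v n \<in> F" "\<And>n. a n \<in> v n" by metis
  have "\<not> inj v"
    using v(1) F(1) by (meson finite_imageD finite_subset image_subset_iff infinite_UNIV_nat)
  then obtain m n where "m < n" "v m = v n"
    unfolding inj_on_def by (metis linorder_neqE_nat)
  moreover have "a m \<in> v m" "a n \<in> v m" "v m \<in> W ` carrier K"
    using v F \<open>v m = v n\<close> by (metis, metis, blast)
  ultimately show ?thesis using W by blast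
qed

text \<open>Every conjugate of the unit is the unit, so the open preimage of \<open>U\<close> under
  \<open>?q\<close> contains the slice of all \<open>(g, \<one>)\<close>. By compactness of
  \<open>K\<close> the tube lemma thickens this slice.\<close>

lemma compact_group_small_conjugates:
  assumes K: "compact_group K" and U: "openin (topol K) U" "\<one>\<^bsub>K\<^esub> \<in> U"
  obtains V where "openin (topol K) V" "\<one>\<^bsub>K\<^esub> \<in> V"
    "\<And>g x. g \<in> carrier K \<Longrightarrow> x \<in> V \<Longrightarrow> inv\<^bsub>K\<^esub> g \<otimes>\<^bsub>K\<^esub> x \<otimes>\<^bsub>K\<^esub> g \<in> U"
proof -
  let ?T = "topol K" and ?q = "\<lambda>p. inv\<^bsub>K\<^esub> fst p \<otimes>\<^bsub>K\<^esub> snd p \<otimes>\<^bsub>K\<^esub> fst p"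
  have tK: "topological_group K" and cK: "compact_space ?T"
    using K by (auto simp: compact_group_def hausdorff_groupD)
  note KD = topological_groupD[OF tK]
  interpret group K by (rule KD)
  have "continuous_map (prod_topology ?T ?T) ?T ?q"
    by (intro continuous_map_mult continuous_map_inverse tK continuous_map_fst continuous_map_snd)
  from openin_continuous_map_preimage[OF this U(1)]
  have op: "openin (prod_topology ?T ?T) {p \<in> topspace (prod_topology ?T ?T). ?q p \<in> U}" .
  have "\<exists>A V. openin ?T A \<and> openin ?T V \<and> carrier K \<subseteq> A \<and> \<one>\<^bsub>K\<^esub> \<in> V \<and>
      A \<times> V \<subseteq> {p \<in> topspace (prod_topology ?T ?T). ?q p \<in> U}"
    by (rule tube_lemma_left[OF op]) (use cK KD U in \<open>auto simp: compact_space_def\<close>)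
  then obtain A V where AV: "openin ?T V" "carrier K \<subseteq> A" "\<one>\<^bsub>K\<^esub> \<in> V"
      "A \<times> V \<subseteq> {p \<in> topspace (prod_topology ?T ?T). ?q p \<in> U}"
    by blast
  show ?thesis
  proof
    fix g x assume "g \<in> carrier K" "x \<in> V"
    then have "(g, x) \<in> A \<times> V" using AV by auto
    with AV(4) have "?q (g, x) \<in> U" by blast
    then show "inv\<^bsub>K\<^esub> g \<otimes>\<^bsub>K\<^esub> x \<otimes>\<^bsub>K\<^esub> g \<in> U" by simp
  qed (use AV in auto)
qed

text \<open>If the unit were isolated, it would be the only element mapped into some neighbourhood
  of the unit of the compact group \<open>bohr_compactification X\<close>. Some quotient of two
  terms of an injective sequence also lands there.\<close>

lemma bohr_topol_not_discrete:
  assumes X: "topological_group X" and inf: "infinite (carrier X)"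
  shows "\<not> openin (topol (bohr X)) {\<one>\<^bsub>X\<^esub>}"
proof
  assume "openin (topol (bohr X)) {\<one>\<^bsub>X\<^esub>}"
  then obtain U where U: "openin (topol (bohr_compactification X)) U"
    "{\<one>\<^bsub>X\<^esub>} = bohr_map X -` U \<inter> carrier X"
    by (auto simp: bohr_def openin_pullback_topology)
  let ?K = "bohr_compactification X"
  interpret X: group X using X by (rule topological_groupD)
  interpret h: group_hom X ?K "bohr_map X"
    using bohr_map_hom[OF X] topological_groupD(1)
    by (simp add: group_hom_def group_hom_axioms_def X.group_axioms)
  obtain a :: "nat \<Rightarrow> 'a" where a: "inj a" "range a \<subseteq> carrier X"
    using inf infinite_countable_subset by blast
  have ac: "a n \<in> carrier X" for n using a by auto
  have "bohr_map X \<one>\<^bsub>X\<^esub> \<in> U" using U(2) by blast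
  then have "\<exists>m n. m < n \<and> inv\<^bsub>?K\<^esub> bohr_map X (a m) \<otimes>\<^bsub>?K\<^esub> bohr_map X (a n) \<in> U"
    using compact_group_sequence_quotient[OF compact_group_bohr_compactification[OF X],
        of "\<lambda>n. bohr_map X (a n)", OF _ U(1)] ac by auto
  then obtain m n where mn: "m < n" "inv\<^bsub>?K\<^esub> bohr_map X (a m) \<otimes>\<^bsub>?K\<^esub> bohr_map X (a n) \<in> U"
    by blast
  then have "bohr_map X (inv\<^bsub>X\<^esub> a m \<otimes>\<^bsub>X\<^esub> a n) \<in> U"
    using ac by simp
  then have "inv\<^bsub>X\<^esub> a m \<otimes>\<^bsub>X\<^esub> a n \<in> bohr_map X -` U \<inter> carrier X"
    using ac by simp
  then have "inv\<^bsub>X\<^esub> a m \<otimes>\<^bsub>X\<^esub> a n = \<one>\<^bsub>X\<^esub>"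
    using U(2) by blast
  then have "a m = a n"
    using ac by (metis X.inv_closed X.inv_equality X.inv_inv)
  then show False using a(1) mn(1) by (auto dest: injD)
qed

section \<open>Discrete groups\<close>

definition discrete_group :: "('a, 'm) monoid_scheme \<Rightarrow> 'a top_group" where
  "discrete_group G = \<lparr>carrier = carrier G, monoid.mult = monoid.mult G, one = one G,
     topol = discrete_topology (carrier G)\<rparr>"

lemma discrete_group_simps [simp]:
  "carrier (discrete_group G) = carrier G" "monoid.mult (discrete_group G) = monoid.mult G"
  "one (discrete_group G) = one G" "topol (discrete_group G) = discrete_topology (carrier G)"
  by (simp_all add: discrete_group_def)

lemma hausdorff_group_discrete:
  assumes "group G"
  shows "hausdorff_group (discrete_group G)"
proof -
  have g: "group (discrete_group G)"
    using assms group_cong[of "discrete_group G" G] by simp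
  then show ?thesis
    using group.is_monoid[OF g] group.inv_closed[OF g] monoid.m_closed[OF group.is_monoid[OF g]]
    by (auto simp: hausdorff_group_def topological_group_def continuous_map_from_discrete_topology
        Hausdorff_space_discrete_topology prod_topology_discrete_topology[symmetric])
qed

text \<open>No topology on the carrier is finer than the discrete one.\<close>

lemma discrete_group_in_s_groups:
  assumes "group G"
  shows "discrete_group G \<in> s_groups"
proof -
  let ?D = "discrete_group G"
  have h: "hausdorff_group ?D" using assms by (rule hausdorff_group_discrete)
  have "openin (topol ?D) U" if "null_admissible ?D T" "openin T U" for T U
  proof -
    have "topspace T = carrier G"
      using that(1) by (simp add: null_admissible_def hausdorff_group_def topological_group_def)
    then show ?thesis using openin_subset[OF that(2)] by simp
  qed
  then have "is_finest_null_admissible ?D (topol ?D)"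
    using null_admissible_self[OF h] by (simp add: is_finest_null_admissible_def)
  then have "s_mod ?D = ?D\<lparr>topol := topol ?D\<rparr>" by (rule s_mod_eqI)
  then show ?thesis using h by (simp add: s_groups_def)
qed

lemma continuous_hom_discrete:
  assumes "topological_group K"
  shows "continuous_hom (discrete_group G) K = hom G K"
  using topological_groupD(2)[OF assms]
  by (auto simp: continuous_hom_def hom_def continuous_map_from_discrete_topology)

lemma null_seqs_discrete:
  "\<sigma> \<in> null_seqs (discrete_group G) \<Longrightarrow> \<forall>\<^sub>F n in sequentially. \<sigma> n = \<one>\<^bsub>G\<^esub>"
  by (auto simp: null_seqs_def limitin_def dest!: spec[of _ "{\<one>\<^bsub>G\<^esub>}"])

text \<open>Eventually trivial sequences converge in the discrete topology, which is therefore
  admissible and thus coarser than the topology of the s-group \<open>X\<close>.\<close>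

lemma s_group_discrete_if_null_seqs_trivial:
  assumes X: "X \<in> s_groups"
    and triv: "\<And>\<sigma>. \<sigma> \<in> null_seqs X \<Longrightarrow> \<forall>\<^sub>F n in sequentially. \<sigma> n = \<one>\<^bsub>X\<^esub>"
  shows "openin (topol X) {\<one>\<^bsub>X\<^esub>}"
proof -
  have hX: "hausdorff_group X" and sX: "s_mod X = X"
    using X by (auto simp: s_groups_def)
  have g: "group X" using hX by (rule hausdorff_groupD)
  then have one: "\<one>\<^bsub>X\<^esub> \<in> carrier X" by (simp add: group.is_monoid)
  have eq: "X\<lparr>topol := discrete_topology (carrier X)\<rparr> = discrete_group X"
    by (simp add: discrete_group_def)
  have "hausdorff_group (X\<lparr>topol := discrete_topology (carrier X)\<rparr>)"
    unfolding eq by (rule hausdorff_group_discrete[OF g])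
  moreover have "limitin (discrete_topology (carrier X)) \<sigma> \<one>\<^bsub>X\<^esub> sequentially" if "\<sigma> \<in> null_seqs X" for \<sigma>
    using triv[OF that] one by (auto simp: limitin_def elim: eventually_mono)
  ultimately have "null_admissible X (discrete_topology (carrier X))"
    by (simp add: null_admissible_def)
  then show ?thesis
    using s_mod_finest[OF hX] sX one by (simp add: is_finest_null_admissible_def)
qed

text \<open>Provides the injection along which the countable witnesses are moved to an arbitrary
  infinite type.\<close>

lemma countable_inj_on_into_infinite:
  assumes "countable A" "infinite (UNIV :: 'c set)"
  shows "\<exists>h :: 'a \<Rightarrow> 'c. inj_on h A"
proof -
  obtain g :: "nat \<Rightarrow> 'c" where "inj g"
    using infinite_countable_subset[OF assms(2)] by blast
  then have "inj_on (g \<circ> to_nat_on A) A"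
    using inj_on_to_nat_on[OF assms(1)] by (meson comp_inj_on inj_on_subset subset_UNIV)
  then show ?thesis by blast
qed

section \<open>An s-group without the Schur property\<close>

text \<open>The pair \<open>(a, b)\<close> encodes the map sending \<open>x\<close> to
  \<open>a * x + b\<close>; the product is composition.\<close>

definition affine_group :: "(rat \<times> rat) monoid" where
  "affine_group = \<lparr>carrier = {p. fst p \<noteq> 0},
     monoid.mult = (\<lambda>(a, b) (c, d). (a * c, a * d + b)), one = (1, 0)\<rparr>"

lemma affine_group_simps [simp]:
  "(a, b) \<in> carrier affine_group \<longleftrightarrow> a \<noteq> 0"
  "(a, b) \<otimes>\<^bsub>affine_group\<^esub> (c, d) = (a * c, a * d + b)"
  "\<one>\<^bsub>affine_group\<^esub> = (1, 0)"
  by (simp_all add: affine_group_def)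

lemma group_affine_group: "group affine_group"
proof (rule groupI)
  fix p assume "p \<in> carrier affine_group"
  then obtain a b where p: "p = (a, b)" "a \<noteq> 0" by (cases p) auto
  then show "\<exists>q\<in>carrier affine_group. q \<otimes>\<^bsub>affine_group\<^esub> p = \<one>\<^bsub>affine_group\<^esub>"
    by (intro bexI[of _ "(1 / a, - b / a)"]) auto
qed (auto simp: split_paired_all algebra_simps)

lemma inv_affine_group:
  assumes "a \<noteq> 0"
  shows "inv\<^bsub>affine_group\<^esub> (a, b) = (1 / a, - b / a)"
  by (rule group.inv_equality[OF group_affine_group]) (use assms in auto)

text \<open>All nontrivial translations are conjugate. By compactness some difference of integer
  translations is mapped arbitrarily close to the unit, and small neighbourhoods of the unit of a
  compact group are stable under conjugation.\<close>

lemma affine_group_hom_compact: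
  assumes K: "compact_group K" and f: "f \<in> hom affine_group K"
  shows "f (1, 1) = \<one>\<^bsub>K\<^esub>"
proof (rule ccontr)
  assume ne: "f (1, 1) \<noteq> \<one>\<^bsub>K\<^esub>"
  have hK: "hausdorff_group K" using K by (simp add: compact_group_def)
  note KD = hausdorff_groupD[OF hK]
  interpret f: group_hom affine_group K f
    using f KD group_affine_group by (simp add: group_hom_def group_hom_axioms_def)
  have c: "f (a, b) \<in> carrier K" if "a \<noteq> 0" for a b
    using f.hom_closed[of "(a, b)"] that by simp
  have mult: "f (a, b) \<otimes>\<^bsub>K\<^esub> f (u, v) = f (a * u, a * v + b)" if "a \<noteq> 0" "u \<noteq> 0" for a b u v
    using f.hom_mult[of "(a, b)" "(u, v)"] that by simp
  have inv: "inv\<^bsub>K\<^esub> f (a, b) = f (1 / a, - b / a)" if "a \<noteq> 0" for a b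
    using f.hom_inv[of "(a, b)"] that by (simp add: inv_affine_group)
  obtain U where U: "openin (topol K) U" "\<one>\<^bsub>K\<^esub> \<in> U" "f (1, 1) \<notin> U"
  proof -
    have "\<one>\<^bsub>K\<^esub> \<in> topspace (topol K)" "f (1, 1) \<in> topspace (topol K)"
      using c KD by auto
    then obtain U V where "openin (topol K) U" "openin (topol K) V" "f (1, 1) \<in> U" "\<one>\<^bsub>K\<^esub> \<in> V" "disjnt U V"
      using ne KD(4) unfolding Hausdorff_space_def by metis
    then show ?thesis using that[of V] by (auto simp: disjnt_iff)
  qed
  obtain V where V: "openin (topol K) V" "\<one>\<^bsub>K\<^esub> \<in> V"
    and conj: "\<And>g x. g \<in> carrier K \<Longrightarrow> x \<in> V \<Longrightarrow> inv\<^bsub>K\<^esub> g \<otimes>\<^bsub>K\<^esub> x \<otimes>\<^bsub>K\<^esub> g \<in> U"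
    using compact_group_small_conjugates[OF K U(1,2)] by metis
  have "\<exists>m n. m < n \<and> inv\<^bsub>K\<^esub> f (1, of_nat m) \<otimes>\<^bsub>K\<^esub> f (1, of_nat n) \<in> V"
    by (rule compact_group_sequence_quotient[OF K _ V]) (simp add: c)
  then obtain m n :: nat where mn: "m < n"
    and inV: "inv\<^bsub>K\<^esub> f (1, of_nat m) \<otimes>\<^bsub>K\<^esub> f (1, of_nat n) \<in> V" by blast
  define k :: rat where "k = of_nat n - of_nat m"
  have k: "k \<noteq> 0" using mn by (simp add: k_def)
  have "f (1, k) \<in> V"
    using inV by (simp add: inv mult k_def)
  \<comment> \<open>Conjugating the translation by \<open>k\<close> with the dilation
    \<open>(k, 0)\<close> gives \<open>(1 / k, 0) (1, k) (k, 0) = (1, 1)\<close>.\<close>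
  from conj[OF c[OF k, of 0] this] have "f (1, 1) \<in> U"
    using k by (simp add: inv mult)
  then show False using U(3) by simp
qed

lemma s_group_not_schur:
  assumes "infinite (UNIV :: 'c set)"
  shows "\<exists>X :: 'c top_group. X \<in> s_groups \<and> X \<notin> schur_groups"
proof -
  obtain h :: "rat \<times> rat \<Rightarrow> 'c" where h: "inj_on h (carrier affine_group)"
    using countable_inj_on_into_infinite[OF _ assms, of "carrier affine_group"] by auto
  define X where "X = discrete_group (image_group h affine_group)"
  have g: "group (image_group h affine_group)"
    by (rule group.inj_imp_image_group_is_group[OF group_affine_group h])
  have hX: "hausdorff_group X" and tX: "topological_group X"
    unfolding X_def using hausdorff_group_discrete[OF g] by (auto simp: hausdorff_groupD)
  have hh: "h \<in> hom affine_group (image_group h affine_group)"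
    using inj_imp_image_group_iso[OF h] by (simp add: iso_def)
  have mem: "h (1, b) \<in> carrier X" for b
    by (simp add: X_def image_group_carrier)
  \<comment> \<open>\<open>h (1, 0)\<close> is the unit of \<open>X\<close>, and by
    \<open>affine_group_hom_compact\<close> no homomorphism into a compact group separates
    \<open>h (1, 1)\<close> from it.\<close>
  have trivial: "f (h (1, 1)) = f (h (1, 0))" if "(K, f) \<in> bohr_index X" for K f
  proof -
    have K: "compact_group K" and f: "f \<in> hom X K"
      using that by (auto simp: bohr_index_def continuous_hom_def)
    then have "f \<circ> h \<in> hom affine_group K"
      using hh by (auto simp: X_def hom_def)
    moreover have "group K" using K by (simp add: compact_group_def hausdorff_groupD)
    ultimately show ?thesis
      using affine_group_hom_compact[OF K, of "f \<circ> h"] hom_one[of "f \<circ> h" affine_group K] group_affine_group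
      by simp
  qed
  then have eq: "bohr_map X (h (1, 1)) = bohr_map X (h (1, 0))"
    unfolding bohr_map_def by (intro restrict_ext) (metis prod.collapse)
  have "\<not> MAP X"
  proof
    assume "MAP X"
    then have "Hausdorff_space (topol (bohr X))" by (simp add: MAP_def)
    moreover have "h (1, 1) \<noteq> h (1, 0)"
      using inj_onD[OF h, of "(1, 1)" "(1, 0)"] by auto
    moreover have "topspace (topol (bohr X)) = carrier X"
      using topological_groupD(2)[OF topological_group_bohr[OF tX]] by simp
    ultimately obtain U V where "openin (topol (bohr X)) U" "h (1, 1) \<in> U"
      "openin (topol (bohr X)) V" "h (1, 0) \<in> V" "disjnt U V"
      unfolding Hausdorff_space_def using mem by metis
    \<comment> \<open>Bohr-open sets are preimages under \<open>bohr_map X\<close>, so they cannot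
      tell the two points apart.\<close>
    then have "h (1, 0) \<in> U \<inter> V"
      using mem eq by (auto simp: bohr_def openin_pullback_topology)
    then show False using \<open>disjnt U V\<close> by (auto simp: disjnt_iff)
  qed
  then have "X \<notin> schur_groups" by (simp add: schur_groups_def)
  moreover have "X \<in> s_groups"
    unfolding X_def by (rule discrete_group_in_s_groups[OF g])
  ultimately show ?thesis by blast
qed

section \<open>A group with the Schur property that is not an s-group\<close>

text \<open>The direct sum of countably many groups of order two, each vector encoded by its
  support.\<close>

definition finite_sets_group :: "nat set monoid" where
  "finite_sets_group = \<lparr>carrier = {F. finite F}, monoid.mult = sym_diff, one = {}\<rparr>"

definition parity_group :: "bool top_group" where
  "parity_group = discrete_group \<lparr>carrier = UNIV, monoid.mult = (\<noteq>), one = False\<rparr>"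

lemma group_finite_sets_group: "group finite_sets_group"
proof (rule groupI)
  fix F assume "F \<in> carrier finite_sets_group"
  then show "\<exists>G\<in>carrier finite_sets_group. G \<otimes>\<^bsub>finite_sets_group\<^esub> F = \<one>\<^bsub>finite_sets_group\<^esub>"
    by (intro bexI[of _ F]) (auto simp: finite_sets_group_def)
qed (auto simp: finite_sets_group_def)

lemma compact_group_parity_group: "compact_group parity_group"
proof -
  have "group \<lparr>carrier = UNIV, monoid.mult = (\<noteq>), one = False\<rparr>"
    by (rule groupI) auto
  from hausdorff_group_discrete[OF this] show ?thesis
    by (simp add: compact_group_def parity_group_def compact_space_discrete_topology)
qed

text \<open>Elements common to \<open>F\<close> and \<open>G\<close> are counted in both
  cardinalities and cancel modulo two. \<open>A\<close> may be infinite;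
  \<open>eventually_empty_if_parities_vanish\<close> takes for it an infinite set of maxima.\<close>

lemma parity_hom: "(\<lambda>F. odd (card (F \<inter> A))) \<in> hom finite_sets_group parity_group"
proof (rule homI)
  fix F G assume "F \<in> carrier finite_sets_group" "G \<in> carrier finite_sets_group"
  then have fin: "finite (F \<inter> A)" "finite (G \<inter> A)" by (auto simp: finite_sets_group_def)
  have "card (F \<inter> A) = card (F \<inter> A - G \<inter> A) + card (F \<inter> A \<inter> (G \<inter> A))"
    "card (G \<inter> A) = card (G \<inter> A - F \<inter> A) + card (F \<inter> A \<inter> (G \<inter> A))"
    using fin card_Int_Diff[of "F \<inter> A" "G \<inter> A"] card_Int_Diff[of "G \<inter> A" "F \<inter> A"]
    by (simp_all add: Int_commute)
  moreover have "card (sym_diff F G \<inter> A) = card (F \<inter> A - G \<inter> A) + card (G \<inter> A - F \<inter> A)"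
  proof -
    have "sym_diff F G \<inter> A = (F \<inter> A - G \<inter> A) \<union> (G \<inter> A - F \<inter> A)" by blast
    then show ?thesis using fin by (simp add: card_Un_disjoint Diff_Int_distrib2 disjnt_def)
  qed
  ultimately show "odd (card ((F \<otimes>\<^bsub>finite_sets_group\<^esub> G) \<inter> A)) =
      odd (card (F \<inter> A)) \<otimes>\<^bsub>parity_group\<^esub> odd (card (G \<inter> A))"
    by (auto simp: finite_sets_group_def parity_group_def)
qed (simp add: parity_group_def)

text \<open>Otherwise, a subsequence of nonempty sets lies in successive blocks, and the set of the maxima
  of these blocks meets each member of the subsequence in exactly one point.\<close>

lemma eventually_empty_if_parities_vanish:
  fixes \<sigma> :: "nat \<Rightarrow> nat set"
  assumes fin: "\<And>n. finite (\<sigma> n)"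
    and even: "\<And>A. \<forall>\<^sub>F n in sequentially. even (card (\<sigma> n \<inter> A))"
  shows "\<forall>\<^sub>F n in sequentially. \<sigma> n = {}"
proof (rule ccontr)
  assume nonempty: "\<not> ?thesis"
  \<comment> \<open>The test set is a singleton: a subset of \<open>{k}\<close> of even size is
    empty.\<close>
  have avoid: "\<forall>\<^sub>F n in sequentially. k \<notin> \<sigma> n" for k
    using even[of "{k}"] by (rule eventually_mono) (auto split: if_splits)
  have step: "\<exists>n>N. \<sigma> n \<noteq> {} \<and> (\<forall>x\<in>\<sigma> n. b < x)" for N b
  proof -
    have "\<forall>\<^sub>F n in sequentially. \<forall>k\<in>{..b}. k \<notin> \<sigma> n"
      using avoid by (intro eventually_ball_finite) auto
    with eventually_gt_at_top[of N] have "\<forall>\<^sub>F n in sequentially. n > N \<and> (\<forall>k\<in>{..b}. k \<notin> \<sigma> n)"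
      by (rule eventually_conj)
    moreover have "\<exists>\<^sub>F n in sequentially. \<sigma> n \<noteq> {}"
      using nonempty by (simp add: frequently_def)
    ultimately have "\<exists>\<^sub>F n in sequentially. (n > N \<and> (\<forall>k\<in>{..b}. k \<notin> \<sigma> n)) \<and> \<sigma> n \<noteq> {}"
      by (rule frequently_eventually_conj[rotated])
    from frequently_ex[OF this] obtain n where "\<sigma> n \<noteq> {}" "n > N" "\<forall>k\<in>{..b}. k \<notin> \<sigma> n"
      by blast
    then show ?thesis by (metis atMost_iff not_le)
  qed
  obtain r where r: "\<And>j. \<sigma> (r j) \<noteq> {}"
    and rs: "\<And>j. r j < r (Suc j) \<and> (\<forall>x\<in>\<sigma> (r (Suc j)). Max (\<sigma> (r j)) < x)"
    using dependent_nat_choice[of "\<lambda>_ n. \<sigma> n \<noteq> {}"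
        "\<lambda>_ m n. m < n \<and> (\<forall>x\<in>\<sigma> n. Max (\<sigma> m) < x)"] step by metis
  define M where "M j = Max (\<sigma> (r j))" for j
  have M: "M j \<in> \<sigma> (r j)" for j
    unfolding M_def by (rule Max_in[OF fin r])
  have mono_M: "strict_mono M"
    using rs M by (auto simp: strict_mono_Suc_iff M_def)
  have "\<sigma> (r j) \<inter> range M = {M j}" for j
  proof -
    have "i = j" if i: "M i \<in> \<sigma> (r j)" for i
    proof (rule ccontr)
      assume "i \<noteq> j"
      \<comment> \<open>The maximum of a later block is too large for block \<open>j\<close>. That
        of an earlier block is at most \<open>M l\<close>, below every element of block
        \<open>Suc l\<close>.\<close>
      then consider "j < i" | l where "j = Suc l" "i \<le> l"
        by (metis less_Suc_eq_le linorder_neqE_nat not0_implies_Suc not_less0)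
      then show False
      proof cases
        case 1
        then show False
          using strict_monoD[OF mono_M 1] Max_ge[OF fin i] by (simp add: M_def)
      next
        case 2
        then have "M l < M i" using rs[of l] i by (simp add: M_def)
        then show False using strict_mono_less_eq[OF mono_M, of i l] \<open>i \<le> l\<close> by (simp add: not_less)
      qed
    qed
    then show ?thesis using M by auto
  qed
  then have odd: "odd (card (\<sigma> (r j) \<inter> range M))" for j by simp
  obtain N where N: "\<And>n. n \<ge> N \<Longrightarrow> even (card (\<sigma> n \<inter> range M))"
    using even[of "range M"] by (auto simp: eventually_sequentially)
  have "strict_mono r" using rs by (simp add: strict_mono_Suc_iff)
  \<comment> \<open>The index \<open>r N\<close> of a set meeting \<open>range M\<close> in one
    point is beyond the bound from which the parities are even.\<close>
  then have "N \<le> r N" by (rule seq_suble)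
  then show False using N odd by blast
qed

lemma schur_group_not_s_group:
  assumes "infinite (UNIV :: 'c set)"
  shows "\<exists>X :: 'c top_group. X \<in> schur_groups \<and> X \<notin> s_groups"
proof -
  let ?V = finite_sets_group
  have "countable (carrier ?V)"
    using countable_Collect_finite by (simp add: finite_sets_group_def)
  then obtain h :: "nat set \<Rightarrow> 'c" where h: "inj_on h (carrier ?V)"
    using countable_inj_on_into_infinite[OF _ assms] by blast
  define g where "g = inv_into (carrier ?V) h"
  define D where "D = discrete_group (image_group h ?V)"
  have gD: "group (image_group h ?V)"
    by (rule group.inj_imp_image_group_is_group[OF group_finite_sets_group h])
  have hD: "hausdorff_group D" and tD: "topological_group D"
    unfolding D_def using hausdorff_group_discrete[OF gD] by (auto simp: hausdorff_groupD)
  have carD: "carrier D = h ` carrier ?V"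
    by (simp add: D_def image_group_carrier)
  have tP: "topological_group parity_group"
    using compact_group_parity_group by (simp add: compact_group_def hausdorff_groupD)
  have hg: "h (g x) = x" "finite (g x)" if "x \<in> carrier D" for x
    using that f_inv_into_f[of x h "carrier ?V"] inv_into_into[of x h "carrier ?V"]
    by (auto simp: carD g_def finite_sets_group_def)
  have "g \<in> hom (image_group h ?V) ?V"
    unfolding g_def using group.iso_set_sym[OF group_finite_sets_group inj_imp_image_group_iso[OF h]]
    by (simp add: iso_def)
  from hom_compose[OF this parity_hom]
  have parity: "(\<lambda>x. odd (card (g x \<inter> A))) \<in> continuous_hom D parity_group" for A
    by (simp add: D_def continuous_hom_discrete[OF tP] o_def)
  \<comment> \<open>Distinct finite sets differ at some \<open>k\<close>, and the parity for the
    singleton \<open>{k}\<close> separates them.\<close>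
  have "MAP D"
  proof (rule MAP_I[where 'b = bool, OF hD])
    fix x y assume xy: "x \<in> carrier D" "y \<in> carrier D" "x \<noteq> y"
    then have "g x \<noteq> g y" using hg by metis
    then obtain k where "k \<in> g x \<longleftrightarrow> k \<notin> g y" by blast
    then have "odd (card (g x \<inter> {k})) \<noteq> odd (card (g y \<inter> {k}))" by auto
    then show "\<exists>(C :: bool top_group) f. compact_group C \<and> f \<in> continuous_hom D C \<and> f x \<noteq> f y"
      using compact_group_parity_group parity by blast
  qed
  \<comment> \<open>By \<open>bohr (bohr D) = bohr D\<close> the two sets of convergent sequences
    are the same.\<close>
  have "bohr D \<in> schur_groups"
    using MAP_bohr[OF \<open>MAP D\<close>] bohr_bohr[OF tD] by (simp add: schur_groups_def)
  moreover have "bohr D \<notin> s_groups"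
  proof
    assume s: "bohr D \<in> s_groups"
    \<comment> \<open>Each parity is a continuous homomorphism on \<open>bohr D\<close> into a
      discrete group, so along a null sequence it is eventually zero.\<close>
    have "\<forall>\<^sub>F n in sequentially. \<sigma> n = \<one>\<^bsub>bohr D\<^esub>" if \<sigma>: "\<sigma> \<in> null_seqs (bohr D)" for \<sigma>
    proof -
      have c: "\<sigma> n \<in> carrier D" for n using \<sigma> by (auto simp: null_seqs_def)
      have "\<forall>\<^sub>F n in sequentially. even (card (g (\<sigma> n) \<inter> A))" for A
      proof -
        have "(\<lambda>x. odd (card (g x \<inter> A))) \<in> continuous_hom (bohr D) parity_group"
          using parity continuous_hom_bohr_iff[OF tD compact_group_parity_group] by simp
        then have "(\<lambda>x. odd (card (g x \<inter> A))) \<circ> \<sigma> \<in> null_seqs parity_group"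
          by (intro null_seqs_hom[OF _ _ _ _ \<sigma>] topological_groupD(1) topological_group_bohr tD tP)
            (simp_all add: continuous_hom_def)
        then show ?thesis
          using null_seqs_discrete by (fastforce simp: parity_group_def)
      qed
      then have "\<forall>\<^sub>F n in sequentially. g (\<sigma> n) = {}"
        by (intro eventually_empty_if_parities_vanish) (use hg c in simp_all)
      then show ?thesis
      proof (rule eventually_mono)
        fix n assume "g (\<sigma> n) = {}"
        then have "\<sigma> n = h {}" using hg(1)[OF c[of n]] by simp
        then show "\<sigma> n = \<one>\<^bsub>bohr D\<^esub>"
          by (simp add: D_def image_group_one) (simp add: finite_sets_group_def)
      qed
    qed
    \<comment> \<open>As an s-group, \<open>bohr D\<close> would be discrete, which an infinite
      group is never in its Bohr topology.\<close>
    from s_group_discrete_if_null_seqs_trivial[OF s this]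
    have "openin (topol (bohr D)) {\<one>\<^bsub>D\<^esub>}" by simp
    moreover have "infinite (carrier D)"
    proof -
      have "infinite (range (\<lambda>n :: nat. {n}))"
        by (intro range_inj_infinite) (simp add: inj_def)
      moreover have "range (\<lambda>n :: nat. {n}) \<subseteq> carrier ?V" by (auto simp: finite_sets_group_def)
      ultimately have "infinite (carrier ?V)" using finite_subset by blast
      then show ?thesis unfolding carD using h finite_imageD by blast
    qed
    ultimately show False using bohr_topol_not_discrete[OF tD] by blast
  qed
  ultimately show ?thesis by blast
qed

section \<open>The Bohr functor and s-groups\<close>

text \<open>If the equation holds, \<open>X\<close> inherits the null sequences of
  \<open>bohr X\<close>, hence has the Schur property; then \<open>s_mod X\<close> equals
  \<open>s_mod (bohr X)\<close>, which is \<open>X\<close>.\<close>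

lemma s_schur_iff:
  assumes X: "MAP X"
  shows "X \<in> s_groups \<inter> schur_groups \<longleftrightarrow> s_mod (bohr X) = X"
proof
  assume "X \<in> s_groups \<inter> schur_groups"
  then show "s_mod (bohr X) = X"
    using schur_iff_s_mod_bohr[OF X] by (simp add: s_groups_def)
next
  assume eq: "s_mod (bohr X) = X"
  have "null_seqs (bohr X) = null_seqs X"
    using null_seqs_s_mod[OF hausdorff_group_bohr[OF X]] eq by simp
  then have "X \<in> schur_groups" using schur_iff_null_seqs[OF X] by simp
  moreover have "s_mod X = X" using calculation schur_iff_s_mod_bohr[OF X] eq by simp
  ultimately show "X \<in> s_groups \<inter> schur_groups"
    using X by (simp add: s_groups_def MAP_def)
qed

text \<open>Null sequences pass from \<open>X\<close> to the coarser \<open>bohr X\<close>, by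
  \<open>\<phi>\<close> to \<open>bohr Y\<close>, and by the Schur property back to
  \<open>Y\<close>.\<close>

lemma continuous_if_bohr_continuous:
  assumes "MAP X" "MAP Y" "X \<in> s_groups" "Y \<in> schur_groups" and \<phi>: "\<phi> \<in> hom X Y"
    and cont: "continuous_map (topol (bohr X)) (topol (bohr Y)) \<phi>"
  shows "continuous_map (topol X) (topol Y) \<phi>"
proof (rule continuous_hom_from_s_group[OF \<open>X \<in> s_groups\<close> _ \<phi>])
  have X: "topological_group X" and Y: "topological_group Y"
    using assms by (auto simp: MAP_def hausdorff_groupD)
  show "topological_group Y" by (rule Y)
  fix \<sigma> assume \<sigma>: "\<sigma> \<in> null_seqs X"
  have "\<sigma> \<in> null_seqs (bohr X)"
    using \<sigma> limitin_coarser[of "topol X" \<sigma> "\<one>\<^bsub>X\<^esub>" sequentially "topol (bohr X)"] bohr_topol_coarser[OF X]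
      topological_groupD(2)[OF X] topological_groupD(2)[OF topological_group_bohr[OF X]]
    by (simp add: null_seqs_def)
  moreover have "\<phi> \<in> hom (bohr X) (bohr Y)" using \<phi> by (simp add: hom_def)
  ultimately have "\<phi> \<circ> \<sigma> \<in> null_seqs (bohr Y)"
    by (intro null_seqs_hom[OF _ cont] topological_groupD(1)[OF topological_group_bohr] X Y)
  then show "\<phi> \<circ> \<sigma> \<in> null_seqs Y"
    using schur_iff_null_seqs assms by blast
qed

theorem proposition7p5:
  fixes X :: "'a top_group" and Y :: "'b top_group"
  assumes "MAP X" and "MAP Y"
  shows "(X \<in> schur_groups \<longleftrightarrow> (s_mod \<circ> bohr) X = s_mod X) \<and>
    (X \<in> s_groups \<inter> schur_groups \<longleftrightarrow> (s_mod \<circ> bohr) X = X) \<and>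
    (infinite (UNIV :: 'c set) \<longrightarrow>
       s_groups \<inter> schur_groups \<subset> (s_groups :: 'c top_group set) \<and>
       s_groups \<inter> schur_groups \<subset> (schur_groups :: 'c top_group set)) \<and>
    (X \<in> s_groups \<longrightarrow> Y \<in> schur_groups \<longrightarrow>
       (\<forall>\<phi>\<in>hom X Y. continuous_map (topol (bohr X)) (topol (bohr Y)) \<phi> \<longrightarrow>
          continuous_map (topol X) (topol Y) \<phi>))"
proof (intro conjI impI ballI)
  show "X \<in> schur_groups \<longleftrightarrow> (s_mod \<circ> bohr) X = s_mod X"
    using schur_iff_s_mod_bohr[OF assms(1)] by simp
  show "X \<in> s_groups \<inter> schur_groups \<longleftrightarrow> (s_mod \<circ> bohr) X = X"
    using s_schur_iff[OF assms(1)] by simp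
  show "s_groups \<inter> schur_groups \<subset> (s_groups :: 'c top_group set)" if "infinite (UNIV :: 'c set)"
    using s_group_not_schur[OF that] by blast
  show "s_groups \<inter> schur_groups \<subset> (schur_groups :: 'c top_group set)" if "infinite (UNIV :: 'c set)"
    using schur_group_not_s_group[OF that] by blast
  show "continuous_map (topol X) (topol Y) \<phi>"
    if "X \<in> s_groups" "Y \<in> schur_groups" "\<phi> \<in> hom X Y"
      "continuous_map (topol (bohr X)) (topol (bohr Y)) \<phi>" for \<phi>
    using continuous_if_bohr_continuous[OF assms] that by blast
qed

end
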